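(* Let $G$ be a finitely generated virtually abelian group, with a finite-index normal free abelian subgroup $\mathbb{Z}^k$, let $T$ be a right transversal of $\mathbb{Z}^k$ in $G$, let $\Sigma=\{a_1^{\pm1},\ldots,a_k^{\pm1}\}$ be the standard generating set of $\mathbb{Z}^k$, and let $\zeta\colon G\to(\Sigma\cup T)^*$ be the normal form sending $g=a_1^{i_1}\cdots a_k^{i_k}t$ (with $i_1,\ldots,i_k\in\mathbb{Z}$, $t\in T$, uniquely determined by $g$) to the word $a_1^{i_1}\cdots a_k^{i_k}t$. Then the $\#$-joined solution language, with respect to $\Sigma\cup T$ and $\zeta$, of every finite system of equations in $G$ is an EDT0L language.
   Context: Functions are written to the right of their arguments. Equations: a finite system of equations in $G$ is a finite subset $\{w_1,\ldots,w_m\}$ of $G*F_V$, where $F_V$ is the free group on a finite set $V=\{X_1,\ldots,X_n\}$ of variables. A solution is a homomorphism $\psi\colon F_V\to G$ such that $w_1\bar\psi=\cdots=w_m\bar\psi=1_G$, where $\bar\psi\colon G*F_V\to G$ extends $\psi$ by the identity on $G$. $\#$-joined solution language: with respect to a finite monoid generating set $\Omega$ and a normal form $\eta\colon G\to\Omega^*$ (choosing a word representing each element), it is $\{X_1\psi\eta\,\#\,X_2\psi\eta\,\#\cdots\#\,X_n\psi\eta\mid\psi\text{ a solution}\}\subseteq(\Omega\cup\{\#\})^*$, where $\#$ is a new letter. EDT0L: an EDT0L system is a tuple $(\Omega,C,w,\mathcal{R})$ where $\Omega$ is a (finite) alphabet, $C\supseteq\Omega$ is a finite alphabet (extended alphabet),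 $w\in C^*$ is the start word, and $\mathcal{R}\subseteq\mathrm{End}(C^* )$ is a regular set of endomorphisms, i.e. the set of compositions (read left to right) spelled by the words of some regular language over a finite set of endomorphisms of the free monoid $C^*$. The language it accepts is $\{w\phi\mid\phi\in\mathcal{R}\}$, which is required to be a language over $\Omega$. A language is EDT0L if it is accepted by some EDT0L system. *)

theory Defs
  imports "HOL-Algebra.Free_Abelian_Groups"
begin

section \<open>Monoids given by generators and relations\<close>

inductive_set word_cong :: "'a set \<Rightarrow> ('a list \<times> 'a list) set \<Rightarrow> ('a list \<times> 'a list) set"
  for A :: "'a set" and R :: "('a list \<times> 'a list) set" where
  rel: "(u, v) \<in> R \<Longrightarrow> {p, q, u, v} \<subseteq> lists A \<Longrightarrow> (p @ u @ q, p @ v @ q) \<in> word_cong A R"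
| refl: "u \<in> lists A \<Longrightarrow> (u, u) \<in> word_cong A R"
| sym: "(u, v) \<in> word_cong A R \<Longrightarrow> (v, u) \<in> word_cong A R"
| trans: "(u, v) \<in> word_cong A R \<Longrightarrow> (v, w) \<in> word_cong A R \<Longrightarrow> (u, w) \<in> word_cong A R"

definition word_class :: "'a set \<Rightarrow> ('a list \<times> 'a list) set \<Rightarrow> 'a list \<Rightarrow> 'a list set" where
  "word_class A R u = word_cong A R `` {u}"

definition presented_monoid :: "'a set \<Rightarrow> ('a list \<times> 'a list) set \<Rightarrow> 'a list set monoid" where
  "presented_monoid A R =
    \<lparr>carrier = lists A // word_cong A R,
     mult = (\<lambda>P Q. \<Union>p\<in>P. \<Union>q\<in>Q. word_class A R (p @ q)),
     one = word_class A R []\<rparr>"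

lemma word_cong_lists: "(u, v) \<in> word_cong A R \<Longrightarrow> u \<in> lists A \<and> v \<in> lists A"
  by (induction rule: word_cong.induct) auto

lemma equiv_word_cong: "equiv (lists A) (word_cong A R)"
  by (rule equivI)
    (auto simp: refl_on_def sym_def trans_def       dest: word_cong_lists intro: word_cong.intros)

lemma word_cong_context:
  "(u, v) \<in> word_cong A R \<Longrightarrow> p \<in> lists A \<Longrightarrow> q \<in> lists A \<Longrightarrow> (p @ u @ q, p @ v @ q) \<in> word_cong A R"
proof (induction rule: word_cong.induct)
  case (rel u v p' q')
  then show ?case using word_cong.rel[of u v R "p @ p'" "q' @ q" A] by simp
next
  case (refl u)
  then show ?case by (intro word_cong.refl) auto
qed (blast intro: word_cong.sym word_cong.trans)+

lemma word_cong_append: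
  assumes "(u, u') \<in> word_cong A R" "(v, v') \<in> word_cong A R"
  shows "(u @ v, u' @ v') \<in> word_cong A R"
proof -
  have "(u @ v, u' @ v) \<in> word_cong A R"
    using word_cong_context[OF assms(1), of "[]" v] assms word_cong_lists by fastforce
  moreover have "(u' @ v, u' @ v') \<in> word_cong A R"
    using word_cong_context[OF assms(2), of "u'" "[]"] assms word_cong_lists by fastforce
  ultimately show ?thesis by (rule word_cong.trans)
qed

lemma word_class_eq_iff:
  "u \<in> lists A \<Longrightarrow> v \<in> lists A \<Longrightarrow>
    word_class A R u = word_class A R v \<longleftrightarrow> (u, v) \<in> word_cong A R"
  unfolding word_class_def by (rule eq_equiv_class_iff[OF equiv_word_cong])

lemma carrier_presented_monoid: "carrier (presented_monoid A R) = word_class A R ` lists A"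
  by (auto simp: presented_monoid_def quotient_def word_class_def)

lemma presented_monoidE:
  assumes "x \<in> carrier (presented_monoid A R)"
  obtains u where "u \<in> lists A" "x = word_class A R u"
  using assms unfolding carrier_presented_monoid by (rule imageE) (rule that)

lemma word_class_closed: "u \<in> lists A \<Longrightarrow> word_class A R u \<in> carrier (presented_monoid A R)"
  unfolding carrier_presented_monoid by (rule imageI)

lemma mult_presented_monoid:
  assumes "u \<in> lists A" "v \<in> lists A"
  shows "word_class A R u \<otimes>\<^bsub>presented_monoid A R\<^esub> word_class A R v = word_class A R (u @ v)"
proof -
  have eq: "word_class A R (p @ q) = word_class A R (u @ v)"
    if "p \<in> word_class A R u" "q \<in> word_class A R v" for p q
  proof -
    have "(u, p) \<in> word_cong A R" "(v, q) \<in> word_cong A R"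
      using that unfolding word_class_def by auto
    then have cong: "(u @ v, p @ q) \<in> word_cong A R" by (rule word_cong_append)
    have "p @ q \<in> lists A" "u @ v \<in> lists A" using word_cong_lists[OF cong] by simp_all
    then show ?thesis using word_cong.sym[OF cong] by (rule word_class_eq_iff[THEN iffD2])
  qed
  have self: "w \<in> word_class A R w" if "w \<in> lists A" for w
    unfolding word_class_def using word_cong.refl[OF that] by simp
  have "(\<Union>p\<in>word_class A R u. \<Union>q\<in>word_class A R v. word_class A R (p @ q)) =
      (\<Union>p\<in>word_class A R u. \<Union>q\<in>word_class A R v. word_class A R (u @ v))"
    by (intro SUP_cong HOL.refl eq)
  also have "\<dots> = word_class A R (u @ v)"
    using self[OF assms(1)] self[OF assms(2)] by auto
  finally show ?thesis by (simp add: presented_monoid_def)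
qed

lemma one_presented_monoid: "\<one>\<^bsub>presented_monoid A R\<^esub> = word_class A R []"
  by (simp add: presented_monoid_def)

lemma monoid_presented_monoid: "monoid (presented_monoid A R)"
proof -
  let ?M = "presented_monoid A R" and ?c = "word_class A R"
  have app: "u @ v \<in> lists A" if "u \<in> lists A" "v \<in> lists A" for u v using that by auto
  have Nil: "[] \<in> lists A" by auto
  have 1: "x \<otimes>\<^bsub>?M\<^esub> y \<in> carrier ?M" if x: "x \<in> carrier ?M" and y: "y \<in> carrier ?M" for x y
  proof -
    obtain u where u: "u \<in> lists A" "x = ?c u" using x by (rule presented_monoidE)
    obtain v where v: "v \<in> lists A" "y = ?c v" using y by (rule presented_monoidE)
    show ?thesis unfolding u(2) v(2) mult_presented_monoid[OF u(1) v(1)]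
      by (rule word_class_closed[OF app[OF u(1) v(1)]])
  qed
  have 2: "x \<otimes>\<^bsub>?M\<^esub> y \<otimes>\<^bsub>?M\<^esub> z = x \<otimes>\<^bsub>?M\<^esub> (y \<otimes>\<^bsub>?M\<^esub> z)"
    if x: "x \<in> carrier ?M" and y: "y \<in> carrier ?M" and z: "z \<in> carrier ?M" for x y z
  proof -
    obtain u where u: "u \<in> lists A" "x = ?c u" using x by (rule presented_monoidE)
    obtain v where v: "v \<in> lists A" "y = ?c v" using y by (rule presented_monoidE)
    obtain w where w: "w \<in> lists A" "z = ?c w" using z by (rule presented_monoidE)
    show ?thesis unfolding u(2) v(2) w(2)
      by (simp only: mult_presented_monoid app u(1) v(1) w(1) append_assoc)
  qed
  have 3: "\<one>\<^bsub>?M\<^esub> \<otimes>\<^bsub>?M\<^esub> x = x" and 4: "x \<otimes>\<^bsub>?M\<^esub> \<one>\<^bsub>?M\<^esub> = x" if x: "x \<in> carrier ?M" for x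
  proof -
    obtain u where u: "u \<in> lists A" "x = ?c u" using x by (rule presented_monoidE)
    show "\<one>\<^bsub>?M\<^esub> \<otimes>\<^bsub>?M\<^esub> x = x" and "x \<otimes>\<^bsub>?M\<^esub> \<one>\<^bsub>?M\<^esub> = x"
      unfolding one_presented_monoid u(2) by (simp_all only: mult_presented_monoid u(1) Nil append.simps append_Nil2)
  qed
  have 5: "\<one>\<^bsub>?M\<^esub> \<in> carrier ?M"
    unfolding one_presented_monoid by (rule word_class_closed[OF Nil])
  show ?thesis by (rule monoidI) (fact 1 5 2 3 4)+
qed

lemma group_presented_monoid:
  assumes "\<And>x. x \<in> A \<Longrightarrow> \<exists>y\<in>A. ([y, x], []) \<in> word_cong A R"
  shows "group (presented_monoid A R)"
proof -
  interpret monoid "presented_monoid A R" by (rule monoid_presented_monoid)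
  have inv: "\<exists>v\<in>lists A. (v @ u, []) \<in> word_cong A R" if "u \<in> lists A" for u
    using that
  proof (induction u)
    case Nil
    then show ?case by (intro bexI[of _ "[]"]) (auto intro: word_cong.refl)
  next
    case (Cons x u)
    then obtain v y where v: "v \<in> lists A" "(v @ u, []) \<in> word_cong A R"
      and y: "y \<in> A" "([y, x], []) \<in> word_cong A R" using assms by fastforce
    have "(v @ [y, x] @ u, v @ [] @ u) \<in> word_cong A R"
      using word_cong_context[OF y(2) v(1)] Cons by auto
    then have "((v @ [y]) @ x # u, []) \<in> word_cong A R"
      using v by (auto intro: word_cong.trans)
    then show ?case using v y by (intro bexI[of _ "v @ [y]"]) auto
  qed
  show ?thesis
  proof (rule group_l_invI)
    fix x assume "x \<in> carrier (presented_monoid A R)"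
    then obtain u where u: "u \<in> lists A" "x = word_class A R u" by (rule presented_monoidE)
    obtain v where v: "v \<in> lists A" "(v @ u, []) \<in> word_cong A R"
      using inv[OF u(1)] by blast
    then have "word_class A R v \<otimes>\<^bsub>presented_monoid A R\<^esub> x = \<one>\<^bsub>presented_monoid A R\<^esub>"
      using u by (simp add: mult_presented_monoid one_presented_monoid word_class_eq_iff)
    then show "\<exists>y\<in>carrier (presented_monoid A R).
        y \<otimes>\<^bsub>presented_monoid A R\<^esub> x = \<one>\<^bsub>presented_monoid A R\<^esub>"
      by (rule bexI) (rule word_class_closed[OF v(1)])
  qed
qed

lemma (in monoid) presented_monoid_universal:
  assumes f: "f \<in> A \<rightarrow> carrier G"
    and R: "\<And>u v. (u, v) \<in> R \<Longrightarrow> u \<in> lists A \<Longrightarrow> v \<in> lists A \<Longrightarrow>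
      foldr (\<lambda>x y. f x \<otimes> y) u \<one> = foldr (\<lambda>x y. f x \<otimes> y) v \<one>"
  obtains h where "h \<in> hom (presented_monoid A R) G"
    "\<And>u. u \<in> lists A \<Longrightarrow> h (word_class A R u) = foldr (\<lambda>x y. f x \<otimes> y) u \<one>"
proof -
  let ?e = "\<lambda>u. foldr (\<lambda>x y. f x \<otimes> y) u \<one>"
  have closed: "?e u \<in> carrier G" if "u \<in> lists A" for u
    using that f by (induction u) auto
  have app: "?e (u @ v) = ?e u \<otimes> ?e v" if "u \<in> lists A" "v \<in> lists A" for u v
    using that f closed by (induction u) (auto simp: m_assoc Pi_iff)
  have cong: "?e u = ?e v" if "(u, v) \<in> word_cong A R" for u v
    using that
  proof (induction rule: word_cong.induct)
    case (rel u v p q)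
    then have l: "p \<in> lists A" "q \<in> lists A" "u \<in> lists A" "v \<in> lists A" by auto
    then have "u @ q \<in> lists A" "v @ q \<in> lists A" by auto
    with l show ?case using R[OF rel(1)] by (simp only: app)
  qed auto
  let ?h = "\<lambda>P. ?e (SOME u. u \<in> P)"
  have h: "?h (word_class A R u) = ?e u" if "u \<in> lists A" for u
  proof -
    have "u \<in> word_class A R u"
      using that by (auto simp: word_class_def intro: word_cong.refl)
    then have "(SOME u'. u' \<in> word_class A R u) \<in> word_class A R u" by (rule someI)
    then show ?thesis using cong by (fastforce simp: word_class_def)
  qed
  have 1: "?h x \<in> carrier G" if x: "x \<in> carrier (presented_monoid A R)" for x
  proof -
    obtain u where u: "u \<in> lists A" "x = word_class A R u" using x by (rule presented_monoidE)
    show ?thesis unfolding u(2) h[OF u(1)] by (rule closed[OF u(1)])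
  qed
  have 2: "?h (x \<otimes>\<^bsub>presented_monoid A R\<^esub> y) = ?h x \<otimes> ?h y"
    if x: "x \<in> carrier (presented_monoid A R)" and y: "y \<in> carrier (presented_monoid A R)" for x y
  proof -
    obtain u where u: "u \<in> lists A" "x = word_class A R u" using x by (rule presented_monoidE)
    obtain v where v: "v \<in> lists A" "y = word_class A R v" using y by (rule presented_monoidE)
    have uv: "u @ v \<in> lists A" using u v by auto
    show ?thesis
      unfolding u(2) v(2) mult_presented_monoid[OF u(1) v(1)] h[OF uv] h[OF u(1)] h[OF v(1)]
      using u(1) v(1) by (rule app)
  qed
  have "?h \<in> hom (presented_monoid A R) G" by (rule homI) (fact 1 2)+
  then show ?thesis by (rule that) (rule h)
qed


section \<open>Free groups and free products\<close>

text \<open>The letter \<open>(x, True)\<close> stands for \<open>x\<close> and \<open>(x, False)\<close> for its inverse.\<close>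

definition free_group_rels :: "'v set \<Rightarrow> (('v \<times> bool) list \<times> ('v \<times> bool) list) set" where
  "free_group_rels V = {([(x, b), (x, \<not> b)], []) | x b. x \<in> V}"

definition free_group :: "'v set \<Rightarrow> ('v \<times> bool) list set monoid" where
  "free_group V = presented_monoid (V \<times> UNIV) (free_group_rels V)"

definition free_gen :: "'v set \<Rightarrow> 'v \<Rightarrow> ('v \<times> bool) list set" where
  "free_gen V x = word_class (V \<times> UNIV) (free_group_rels V) [(x, True)]"

definition free_product_rels ::
    "('a, 'c) monoid_scheme \<Rightarrow> ('b, 'd) monoid_scheme \<Rightarrow> (('a + 'b) list \<times> ('a + 'b) list) set" where
  "free_product_rels G H =
    {([Inl \<one>\<^bsub>G\<^esub>], []), ([Inr \<one>\<^bsub>H\<^esub>], [])}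
    \<union> {([Inl x, Inl y], [Inl (x \<otimes>\<^bsub>G\<^esub> y)]) | x y. x \<in> carrier G \<and> y \<in> carrier G}
    \<union> {([Inr x, Inr y], [Inr (x \<otimes>\<^bsub>H\<^esub> y)]) | x y. x \<in> carrier H \<and> y \<in> carrier H}"

definition free_product ::
    "('a, 'c) monoid_scheme \<Rightarrow> ('b, 'd) monoid_scheme \<Rightarrow> ('a + 'b) list set monoid" where
  "free_product G H = presented_monoid (carrier G <+> carrier H) (free_product_rels G H)"

definition free_product_inl ::
    "('a, 'c) monoid_scheme \<Rightarrow> ('b, 'd) monoid_scheme \<Rightarrow> 'a \<Rightarrow> ('a + 'b) list set" where
  "free_product_inl G H x = word_class (carrier G <+> carrier H) (free_product_rels G H) [Inl x]"

definition free_product_inr ::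
    "('a, 'c) monoid_scheme \<Rightarrow> ('b, 'd) monoid_scheme \<Rightarrow> 'b \<Rightarrow> ('a + 'b) list set" where
  "free_product_inr G H y = word_class (carrier G <+> carrier H) (free_product_rels G H) [Inr y]"

lemma group_free_group: "group (free_group V)"
  unfolding free_group_def
proof (rule group_presented_monoid)
  fix z assume "z \<in> V \<times> (UNIV :: bool set)"
  then obtain x b where z: "z = (x, b)" "x \<in> V" by auto
  have "([(x, \<not> b), (x, \<not> \<not> b)], []) \<in> free_group_rels V"
    using z unfolding free_group_rels_def by blast
  from word_cong.rel[OF this, of "[]" "[]" "V \<times> UNIV"]
  show "\<exists>y\<in>V \<times> UNIV. ([y, z], []) \<in> word_cong (V \<times> UNIV) (free_group_rels V)"
    using z by auto
qed

lemma group_free_product: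
  assumes "group G" "group H"
  shows "group (free_product G H)"
  unfolding free_product_def
proof (rule group_presented_monoid)
  interpret G: group G by fact
  interpret H: group H by fact
  let ?A = "carrier G <+> carrier H" and ?R = "free_product_rels G H"
  fix z assume "z \<in> ?A"
  then consider x where "z = Inl x" "x \<in> carrier G" | y where "z = Inr y" "y \<in> carrier H" by auto
  then show "\<exists>y\<in>?A. ([y, z], []) \<in> word_cong ?A ?R"
  proof cases
    case 1
    have "([Inl (inv\<^bsub>G\<^esub> x), Inl x], [Inl \<one>\<^bsub>G\<^esub>]) \<in> ?R"
      using 1 G.inv_closed[of x] G.l_inv[of x] unfolding free_product_rels_def by force
    from word_cong.rel[OF this, of "[]" "[]" ?A]
    have "([Inl (inv\<^bsub>G\<^esub> x), Inl x], [Inl \<one>\<^bsub>G\<^esub>]) \<in> word_cong ?A ?R" using 1 by auto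
    moreover have "([Inl \<one>\<^bsub>G\<^esub>], []) \<in> word_cong ?A ?R"
      using word_cong.rel[of "[Inl \<one>\<^bsub>G\<^esub>]" "[]" ?R "[]" "[]" ?A] by (auto simp: free_product_rels_def)
    ultimately have "([Inl (inv\<^bsub>G\<^esub> x), Inl x], []) \<in> word_cong ?A ?R" by (rule word_cong.trans)
    then show ?thesis using 1 by blast
  next
    case 2
    have "([Inr (inv\<^bsub>H\<^esub> y), Inr y], [Inr \<one>\<^bsub>H\<^esub>]) \<in> ?R"
      using 2 H.inv_closed[of y] H.l_inv[of y] unfolding free_product_rels_def by force
    from word_cong.rel[OF this, of "[]" "[]" ?A]
    have "([Inr (inv\<^bsub>H\<^esub> y), Inr y], [Inr \<one>\<^bsub>H\<^esub>]) \<in> word_cong ?A ?R" using 2 by auto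
    moreover have "([Inr \<one>\<^bsub>H\<^esub>], []) \<in> word_cong ?A ?R"
      using word_cong.rel[of "[Inr \<one>\<^bsub>H\<^esub>]" "[]" ?R "[]" "[]" ?A] by (auto simp: free_product_rels_def)
    ultimately have "([Inr (inv\<^bsub>H\<^esub> y), Inr y], []) \<in> word_cong ?A ?R" by (rule word_cong.trans)
    then show ?thesis using 2 by blast
  qed
qed

lemma (in group) free_group_universal:
  assumes f: "f \<in> V \<rightarrow> carrier G"
  obtains \<psi> where "\<psi> \<in> hom (free_group V) G" "\<And>x. x \<in> V \<Longrightarrow> \<psi> (free_gen V x) = f x"
proof -
  let ?f = "\<lambda>(x, b). if b then f x else inv f x"
  have f': "?f \<in> V \<times> (UNIV :: bool set) \<rightarrow> carrier G" using f by (auto simp: Pi_iff)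
  obtain h where h: "h \<in> hom (free_group V) G"
    "\<And>u. u \<in> lists (V \<times> UNIV) \<Longrightarrow>
      h (word_class (V \<times> UNIV) (free_group_rels V) u) = foldr (\<lambda>x y. ?f x \<otimes> y) u \<one>"
    unfolding free_group_def
    by (rule presented_monoid_universal[OF f', where R = "free_group_rels V"])
      (use f in \<open>auto simp: free_group_rels_def Pi_iff\<close>)
  show ?thesis
    by (rule that[OF h(1)]) (use f in \<open>auto simp: free_gen_def h(2) Pi_iff\<close>)
qed

lemma (in group) free_product_universal:
  assumes K: "group K" and H: "group H" and \<alpha>: "\<alpha> \<in> hom K G" and \<beta>: "\<beta> \<in> hom H G"
  obtains \<Psi> where "\<Psi> \<in> hom (free_product K H) G"
    "\<And>x. x \<in> carrier K \<Longrightarrow> \<Psi> (free_product_inl K H x) = \<alpha> x"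
    "\<And>y. y \<in> carrier H \<Longrightarrow> \<Psi> (free_product_inr K H y) = \<beta> y"
proof -
  let ?f = "case_sum \<alpha> \<beta>"
  have [simp]: "x \<in> carrier K \<Longrightarrow> \<alpha> x \<in> carrier G" "y \<in> carrier H \<Longrightarrow> \<beta> y \<in> carrier G" for x y
    using \<alpha> \<beta> by (auto simp: hom_def)
  have [simp]: "\<alpha> \<one>\<^bsub>K\<^esub> = \<one>" "\<beta> \<one>\<^bsub>H\<^esub> = \<one>"
    using hom_one[OF \<alpha> K] hom_one[OF \<beta> H] is_group by auto
  have f: "?f \<in> carrier K <+> carrier H \<rightarrow> carrier G" by auto
  obtain h where h: "h \<in> hom (free_product K H) G"
    "\<And>u. u \<in> lists (carrier K <+> carrier H) \<Longrightarrow>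
      h (word_class (carrier K <+> carrier H) (free_product_rels K H) u) = foldr (\<lambda>x y. ?f x \<otimes> y) u \<one>"
    unfolding free_product_def
    by (rule presented_monoid_universal[OF f, where R = "free_product_rels K H"])
      (auto simp: free_product_rels_def hom_mult[OF \<alpha>] hom_mult[OF \<beta>])
  show ?thesis
  proof (rule that[OF h(1)])
    show "h (free_product_inl K H x) = \<alpha> x" if "x \<in> carrier K" for x
      using h(2)[of "[Inl x]"] that unfolding free_product_inl_def by auto
    show "h (free_product_inr K H y) = \<beta> y" if "y \<in> carrier H" for y
      using h(2)[of "[Inr y]"] that unfolding free_product_inr_def by auto
  qed
qed


section \<open>Equations in groups\<close>

text \<open>The map \<open>\<Psi>\<close> below is the extension of \<open>\<psi>\<close> by the identity on \<open>G\<close>.\<close>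

definition extends_by_identity ::
    "('a, 'c) monoid_scheme \<Rightarrow> 'v set \<Rightarrow> (('v \<times> bool) list set \<Rightarrow> 'a) \<Rightarrow>
     (('a + ('v \<times> bool) list set) list set \<Rightarrow> 'a) \<Rightarrow> bool" where
  "extends_by_identity G V \<psi> \<Psi> \<longleftrightarrow>
    \<Psi> \<in> hom (free_product G (free_group V)) G \<and>
    (\<forall>g\<in>carrier G. \<Psi> (free_product_inl G (free_group V) g) = g) \<and>
    (\<forall>u\<in>carrier (free_group V). \<Psi> (free_product_inr G (free_group V) u) = \<psi> u)"

definition equation_system ::
    "('a, 'c) monoid_scheme \<Rightarrow> 'v set \<Rightarrow> ('a + ('v \<times> bool) list set) list set set \<Rightarrow> bool" where
  "equation_system G V S \<longleftrightarrow> finite V \<and> finite S \<and> S \<subseteq> carrier (free_product G (free_group V))"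

definition solutions ::
    "('a, 'c) monoid_scheme \<Rightarrow> 'v set \<Rightarrow> ('a + ('v \<times> bool) list set) list set set \<Rightarrow>
     (('v \<times> bool) list set \<Rightarrow> 'a) set" where
  "solutions G V S =
    {\<psi> \<in> hom (free_group V) G.
      \<exists>\<Psi>. extends_by_identity G V \<psi> \<Psi> \<and> (\<forall>w\<in>S. \<Psi> w = \<one>\<^bsub>G\<^esub>)}"

lemma (in group) extends_by_identity_exists:
  assumes "\<psi> \<in> hom (free_group V) G"
  shows "\<exists>\<Psi>. extends_by_identity G V \<psi> \<Psi>"
proof -
  have "(\<lambda>x. x) \<in> hom G G" by (auto simp: hom_def)
  from free_product_universal[OF is_group group_free_group this assms] show ?thesis
    unfolding extends_by_identity_def by metis
qed

lemma (in group) extends_by_identity_unique: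
  assumes "extends_by_identity G V \<psi> \<Psi>" "extends_by_identity G V \<psi> \<Psi>'"
    and "w \<in> carrier (free_product G (free_group V))"
  shows "\<Psi> w = \<Psi>' w"
proof -
  let ?F = "free_group V"
  let ?A = "carrier G <+> carrier ?F" and ?R = "free_product_rels G (free_group V)"
  have P: "group (free_product G ?F)" by (intro group_free_product group_free_group is_group)
  have "\<Psi> (word_class ?A ?R u) = \<Psi>' (word_class ?A ?R u)" if "u \<in> lists ?A" for u
    using that
  proof (induction u)
    case Nil
    have "\<Psi> \<one>\<^bsub>free_product G ?F\<^esub> = \<one>" "\<Psi>' \<one>\<^bsub>free_product G ?F\<^esub> = \<one>"
      using assms(1,2) P is_group by (auto simp: extends_by_identity_def intro!: hom_one)
    then show ?case by (simp add: free_product_def one_presented_monoid)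
  next
    case (Cons z u)
    then have l: "[z] \<in> lists ?A" "u \<in> lists ?A" by auto
    have eq: "word_class ?A ?R (z # u) =
        word_class ?A ?R [z] \<otimes>\<^bsub>free_product G ?F\<^esub> word_class ?A ?R u"
      using mult_presented_monoid[OF l, of ?R] by (simp add: free_product_def)
    have c: "word_class ?A ?R [z] \<in> carrier (free_product G ?F)"
      "word_class ?A ?R u \<in> carrier (free_product G ?F)"
      using l unfolding free_product_def carrier_presented_monoid by blast+
    have "\<Psi> (word_class ?A ?R [z]) = \<Psi>' (word_class ?A ?R [z])"
      using l assms(1,2)
      by (auto simp: extends_by_identity_def free_product_inl_def free_product_inr_def)
    then show ?case
      using assms(1,2) Cons.IH hom_mult[OF _ c] unfolding eq extends_by_identity_def by metis
  qed
  then show ?thesis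
    using assms(3) unfolding free_product_def carrier_presented_monoid by blast
qed

datatype 'a joined_letter = Letter 'a | Hash

fun hash_join :: "'a list list \<Rightarrow> 'a joined_letter list" where
  "hash_join [] = []"
| "hash_join [u] = map Letter u"
| "hash_join (u # v # us) = map Letter u @ Hash # hash_join (v # us)"

text \<open>The finite set of variables is given as the list \<open>Xs\<close> of its elements, since their order
  matters here.\<close>

definition joined_solution_language ::
    "('a, 'c) monoid_scheme \<Rightarrow> ('a \<Rightarrow> 'l list) \<Rightarrow> 'v list \<Rightarrow>
     ('a + ('v \<times> bool) list set) list set set \<Rightarrow> 'l joined_letter list set" where
  "joined_solution_language G \<eta> Xs S =
    {hash_join (map (\<lambda>x. \<eta> (\<psi> (free_gen (set Xs) x))) Xs) | \<psi>. \<psi> \<in> solutions G (set Xs) S}"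


section \<open>Virtually abelian groups\<close>

definition finitely_generated_group :: "('a, 'c) monoid_scheme \<Rightarrow> bool" where
  "finitely_generated_group G \<longleftrightarrow>
    group G \<and> (\<exists>S. finite S \<and> S \<subseteq> carrier G \<and> generate G S = carrier G)"

definition virtually_abelian_group :: "('a, 'c) monoid_scheme \<Rightarrow> bool" where
  "virtually_abelian_group G \<longleftrightarrow>
    group G \<and> (\<exists>H. subgroup H G \<and> comm_group (G\<lparr>carrier := H\<rparr>) \<and> finite (rcosets\<^bsub>G\<^esub> H))"

definition free_abelian_basis :: "('a, 'c) monoid_scheme \<Rightarrow> 'a set \<Rightarrow> nat \<Rightarrow> (nat \<Rightarrow> 'a) \<Rightarrow> bool" where
  "free_abelian_basis G N k a \<longleftrightarrow>
    (\<exists>\<phi>\<in>iso (free_Abelian_group {1..k}) (G\<lparr>carrier := N\<rparr>). \<forall>i\<in>{1..k}. \<phi> (frag_of i) = a i)"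

definition right_transversal :: "('a, 'c) monoid_scheme \<Rightarrow> 'a set \<Rightarrow> 'a set \<Rightarrow> bool" where
  "right_transversal G N T \<longleftrightarrow> T \<subseteq> carrier G \<and> (\<forall>C\<in>rcosets\<^bsub>G\<^esub> N. \<exists>!t. t \<in> T \<and> t \<in> C)"

text \<open>The letters of the alphabet \<open>\<Sigma> \<union> T\<close> are the group elements themselves, so words over it are
  lists of group elements. The last letter of a normal form word is always a member of \<open>T\<close>, also
  when it is the identity.\<close>

definition standard_generators :: "('a, 'c) monoid_scheme \<Rightarrow> nat \<Rightarrow> (nat \<Rightarrow> 'a) \<Rightarrow> 'a set" where
  "standard_generators G k a = a ` {1..k} \<union> (\<lambda>i. inv\<^bsub>G\<^esub> a i) ` {1..k}"

definition power_word :: "('a, 'c) monoid_scheme \<Rightarrow> 'a \<Rightarrow> int \<Rightarrow> 'a list" where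
  "power_word G x n = (if n \<ge> 0 then replicate (nat n) x else replicate (nat (- n)) (inv\<^bsub>G\<^esub> x))"

definition normal_element ::
    "('a, 'c) monoid_scheme \<Rightarrow> nat \<Rightarrow> (nat \<Rightarrow> 'a) \<Rightarrow> (nat \<Rightarrow> int) \<Rightarrow> 'a \<Rightarrow> 'a" where
  "normal_element G k a e t = foldr (\<lambda>i g. (a i [^]\<^bsub>G\<^esub> e i) \<otimes>\<^bsub>G\<^esub> g) [1..<Suc k] t"

definition normal_word ::
    "('a, 'c) monoid_scheme \<Rightarrow> nat \<Rightarrow> (nat \<Rightarrow> 'a) \<Rightarrow> (nat \<Rightarrow> int) \<Rightarrow> 'a \<Rightarrow> 'a list" where
  "normal_word G k a e t = concat (map (\<lambda>i. power_word G (a i) (e i)) [1..<Suc k]) @ [t]"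

definition normal_form ::
    "('a, 'c) monoid_scheme \<Rightarrow> nat \<Rightarrow> (nat \<Rightarrow> 'a) \<Rightarrow> 'a set \<Rightarrow> 'a \<Rightarrow> 'a list" where
  "normal_form G k a T g =
    (THE u. \<exists>e. \<exists>t\<in>T. g = normal_element G k a e t \<and> u = normal_word G k a e t)"


lemma (in group) normal_element_eq:
  assumes N: "subgroup N G"
    and \<phi>: "\<phi> \<in> hom (free_Abelian_group {1..k}) (G\<lparr>carrier := N\<rparr>)"
    and a: "\<And>i. i \<in> {1..k} \<Longrightarrow> \<phi> (frag_of i) = a i" and t: "t \<in> carrier G"
  shows "normal_element G k a e t = \<phi> (\<Sum>i=1..k. frag_cmul (e i) (frag_of i)) \<otimes> t"
proof -
  let ?F = "free_Abelian_group {1..k}" and ?H = "G\<lparr>carrier := N\<rparr>"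
  let ?s = "\<lambda>xs. sum_list (map (\<lambda>i. frag_cmul (e i) (frag_of i)) xs)"
  have H: "group ?H" using N by (rule subgroup.subgroup_is_group) (rule is_group)
  have in_N: "\<phi> c \<in> N" if "Poly_Mapping.keys c \<subseteq> {1..k}" for c
    using hom_carrier[OF \<phi>] that by auto
  have N_G: "x \<in> carrier G" if "x \<in> N" for x using subgroup.mem_carrier[OF N that] .
  have pow: "a i [^] e i = \<phi> (frag_cmul (e i) (frag_of i))" if i: "i \<in> {1..k}" for i
  proof -
    have "\<phi> (frag_of i [^]\<^bsub>?F\<^esub> e i) = a i [^]\<^bsub>?H\<^esub> e i"
      using hom_int_pow[OF \<phi> _ _ H, of "frag_of i" "e i"] i a by simp
    moreover have "a i \<in> N" using in_N[of "frag_of i"] i a by simp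
    ultimately show ?thesis using int_pow_consistent[OF N] i by simp
  qed
  have "foldr (\<lambda>i g. (a i [^] e i) \<otimes> g) xs t = \<phi> (?s xs) \<otimes> t \<and> Poly_Mapping.keys (?s xs) \<subseteq> {1..k}"
    if "set xs \<subseteq> {1..k}" for xs
    using that
  proof (induction xs)
    case Nil
    have "\<phi> 0 = \<one>" using hom_one[OF \<phi> group_free_Abelian_group H] by simp
    then show ?case using t by simp
  next
    case (Cons i xs)
    let ?c = "frag_cmul (e i) (frag_of i)"
    have k: "Poly_Mapping.keys ?c \<subseteq> {1..k}" "Poly_Mapping.keys (?s xs) \<subseteq> {1..k}"
      using Cons keys_cmul[of "e i" "frag_of i"] by auto
    have "\<phi> (?c + ?s xs) = \<phi> ?c \<otimes> \<phi> (?s xs)"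
      using hom_mult[OF \<phi>, of ?c "?s xs"] k by simp
    moreover have "Poly_Mapping.keys (?c + ?s xs) \<subseteq> {1..k}"
      using k Poly_Mapping.keys_add[of ?c "?s xs"] by blast
    ultimately show ?case
      using Cons pow k in_N N_G t by (simp add: m_assoc)
  qed
  moreover have "set [1..<Suc k] \<subseteq> {1..k}" by auto
  ultimately have "normal_element G k a e t = \<phi> (?s [1..<Suc k]) \<otimes> t"
    unfolding normal_element_def by blast
  also have "?s [1..<Suc k] = (\<Sum>i=1..k. frag_cmul (e i) (frag_of i))"
    by (simp only: interv_sum_list_conv_sum_set_nat set_upt atLeastLessThanSuc_atLeastAtMost)
  finally show ?thesis .
qed

lemma lookup_sum_frag:
  fixes k :: nat
  shows "poly_mapping.lookup (\<Sum>i=1..k. frag_cmul (e i) (frag_of i)) j = (if j \<in> {1..k} then e j else 0)"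
proof -
  have "poly_mapping.lookup (\<Sum>i\<in>I. frag_cmul (e i) (frag_of i)) j = (if j \<in> I then e j else 0)"
    if "finite I" for I
    using that by induction (auto simp: lookup_add lookup_single)
  from this[OF finite_atLeastAtMost] show ?thesis .
qed

lemma keys_sum_frag:
  fixes k :: nat
  shows "Poly_Mapping.keys (\<Sum>i=1..k. frag_cmul (e i) (frag_of i)) \<subseteq> {1..k}"
  by (rule subsetI) (simp only: in_keys_iff lookup_sum_frag split: if_splits)

lemma (in group) normal_form_normal_element:
  assumes N: "subgroup N G" and a: "free_abelian_basis G N k a"
    and T: "right_transversal G N T" and t: "t \<in> T"
  shows "normal_form G k a T (normal_element G k a e t) = normal_word G k a e t"
proof -
  obtain \<phi> where \<phi>: "\<phi> \<in> iso (free_Abelian_group {1..k}) (G\<lparr>carrier := N\<rparr>)"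
    and \<phi>a: "\<And>i. i \<in> {1..k} \<Longrightarrow> \<phi> (frag_of i) = a i"
    using a unfolding free_abelian_basis_def by blast
  have hom: "\<phi> \<in> hom (free_Abelian_group {1..k}) (G\<lparr>carrier := N\<rparr>)"
    and inj: "inj_on \<phi> {c. Poly_Mapping.keys c \<subseteq> {1..k}}"
    using \<phi> by (auto simp: iso_def bij_betw_def free_Abelian_group_def)
  have TG: "s \<in> carrier G" if "s \<in> T" for s using T that by (auto simp: right_transversal_def)
  let ?s = "\<lambda>e. \<Sum>i=1..k. frag_cmul (e i) (frag_of i)"
  have sN: "\<phi> (?s e) \<in> N" for e 
  proof -
    have "?s e \<in> carrier (free_Abelian_group {1..k})"
      unfolding carrier_free_Abelian_group_iff by (rule keys_sum_frag)
    from hom_in_carrier[OF hom this] show ?thesis by simp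
  qed
  have NG: "N \<subseteq> carrier G" using N by (rule subgroup.subset)
  have unique: "normal_word G k a e' t' = normal_word G k a e t"
    if t': "t' \<in> T" and eq: "normal_element G k a e t = normal_element G k a e' t'" for e' t'
  proof -
    have eq: "\<phi> (?s e) \<otimes> t = \<phi> (?s e') \<otimes> t'"
      using eq normal_element_eq[OF N hom \<phi>a] TG t t' by simp
    have "\<phi> (?s e) \<otimes> t \<in> N #> t" "\<phi> (?s e') \<otimes> t' \<in> N #> t'"
      using sN by (auto simp: r_coset_def)
    then have "N #> t = N #> t'"
      using eq repr_independence[OF _ _ N] TG t t' by metis
    moreover have "N #> t \<in> rcosets N" using NG TG t by (intro rcosetsI) auto
    moreover have "t \<in> N #> t" "t' \<in> N #> t'" using rcos_self N TG t t' by auto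
    ultimately have "t = t'" using T t t' unfolding right_transversal_def by blast
    have "\<phi> (?s e) \<in> carrier G" "\<phi> (?s e') \<in> carrier G" using sN NG by blast+
    then have "\<phi> (?s e) = \<phi> (?s e')"
      using eq right_cancel[OF TG[OF t]] unfolding \<open>t = t'\<close>[symmetric] by blast
    then have "?s e = ?s e'" by (rule inj_onD[OF inj]) (simp_all only: mem_Collect_eq keys_sum_frag)
    then have "e i = e' i" if "i \<in> {1..k}" for i
      using lookup_sum_frag[of e k i] lookup_sum_frag[of e' k i] that by simp
    then show ?thesis using \<open>t = t'\<close> by (auto simp: normal_word_def intro!: arg_cong[of _ _ concat])
  qed
  show ?thesis unfolding normal_form_def
    by (rule the_equality) (use t unique in blast)+
qed

lemma (in group) normal_element_exists:
  assumes N: "subgroup N G" and a: "free_abelian_basis G N k a"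
    and T: "right_transversal G N T" and g: "g \<in> carrier G"
  obtains e t where "t \<in> T" "g = normal_element G k a e t"
proof -
  obtain \<phi> where \<phi>: "\<phi> \<in> iso (free_Abelian_group {1..k}) (G\<lparr>carrier := N\<rparr>)"
    and \<phi>a: "\<And>i. i \<in> {1..k} \<Longrightarrow> \<phi> (frag_of i) = a i"
    using a unfolding free_abelian_basis_def by blast
  have hom: "\<phi> \<in> hom (free_Abelian_group {1..k}) (G\<lparr>carrier := N\<rparr>)"
    and surj: "\<phi> ` {c. Poly_Mapping.keys c \<subseteq> {1..k}} = N"
    using \<phi> by (auto simp: iso_def bij_betw_def free_Abelian_group_def)
  have "N #> g \<in> rcosets N" using subgroup.subset[OF N] g by (rule rcosetsI)
  then obtain t where t: "t \<in> T" "t \<in> N #> g" using T unfolding right_transversal_def by blast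
  then have tG: "t \<in> carrier G" using T by (auto simp: right_transversal_def)
  have "g \<in> N #> t" using repr_independence[OF t(2) g N] rcos_self[OF g N] by simp
  then obtain n where n: "n \<in> N" "g = n \<otimes> t" by (auto simp: r_coset_def)
  then obtain c where c: "Poly_Mapping.keys c \<subseteq> {1..k}" "n = \<phi> c" using surj by blast
  have "c = (\<Sum>i=1..k. frag_cmul (poly_mapping.lookup c i) (frag_of i))"
    using c(1) by (intro poly_mapping_eqI) (simp only: lookup_sum_frag, auto simp: in_keys_iff)
  then have "g = normal_element G k a (poly_mapping.lookup c) t"
    using normal_element_eq[OF N hom \<phi>a tG] n c by simp
  with t(1) show ?thesis by (rule that)
qed


section \<open>EDT0L languages\<close>

inductive regular_language :: "'e set \<Rightarrow> 'e list set \<Rightarrow> bool" for E :: "'e set" where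
  "regular_language E {}"
| "regular_language E {[]}"
| "x \<in> E \<Longrightarrow> regular_language E {[x]}"
| "regular_language E K \<Longrightarrow> regular_language E L \<Longrightarrow> regular_language E (K \<union> L)"
| "regular_language E K \<Longrightarrow> regular_language E L \<Longrightarrow> regular_language E {u @ v | u v. u \<in> K \<and> v \<in> L}"
| "regular_language E K \<Longrightarrow> regular_language E {concat us | us. us \<in> lists K}"

definition free_monoid :: "'c set \<Rightarrow> 'c list monoid" where
  "free_monoid C = \<lparr>carrier = lists C, mult = (@), one = []\<rparr>"

text \<open>Homomorphisms act on the right, so the word \<open>\<phi>\<^sub>1 \<dots> \<phi>\<^sub>n\<close> spells the map that applies
  \<open>\<phi>\<^sub>1\<close> first, which is \<open>fold (\<lambda>\<phi>. \<phi>) [\<phi>\<^sub>1, \<dots>, \<phi>\<^sub>n]\<close>. Preservation of the empty word by the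
  members of \<open>hom\<close> is automatic, as free monoids are cancellative.\<close>

definition regular_endomorphism_set :: "'c set \<Rightarrow> ('c list \<Rightarrow> 'c list) set \<Rightarrow> bool" where
  "regular_endomorphism_set C \<R> \<longleftrightarrow>
    (\<exists>E K. finite E \<and> E \<subseteq> hom (free_monoid C) (free_monoid C) \<and> regular_language E K \<and>
      \<R> = fold (\<lambda>\<phi>. \<phi>) ` K)"

definition EDT0L_system :: "'c set \<Rightarrow> 'c set \<Rightarrow> 'c list \<Rightarrow> ('c list \<Rightarrow> 'c list) set \<Rightarrow> bool" where
  "EDT0L_system \<Omega> C w \<R> \<longleftrightarrow>
    finite C \<and> \<Omega> \<subseteq> C \<and> w \<in> lists C \<and> regular_endomorphism_set C \<R> \<and>
    (\<forall>\<phi>\<in>\<R>. \<phi> w \<in> lists \<Omega>)"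

definition EDT0L_accepted :: "'c list \<Rightarrow> ('c list \<Rightarrow> 'c list) set \<Rightarrow> 'c list set" where
  "EDT0L_accepted w \<R> = {\<phi> w | \<phi>. \<phi> \<in> \<R>}"

text \<open>\<open>L\<close> is an EDT0L language over the alphabet \<open>\<Omega>\<close>. The letters of the extended alphabet outside
  \<open>\<Omega>\<close> may have to be new, and the type of the letters of \<open>\<Omega>\<close> need not have any to spare; they are
  drawn from a sum with \<^typ>\<open>nat\<close>.\<close>

definition EDT0L_language :: "'l set \<Rightarrow> 'l list set \<Rightarrow> bool" where
  "EDT0L_language \<Omega> L \<longleftrightarrow>
    (\<exists>(C :: ('l + nat) set) w \<R>.
      EDT0L_system (Inl ` \<Omega>) C w \<R> \<and> map Inl ` L = EDT0L_accepted w \<R>)"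

end

theory Submission
  imports Defs "HOL-Library.Function_Algebras"
begin

text \<open>
  Fix for every variable the coset of \<open>N\<close> in which its value lies, that is, its letter from \<open>T\<close>, and
  fix the signs of all exponents. There are finitely many choices, and for each of them a solution is
  a vector of natural numbers, indexed by pairs of a variable and a number in \<open>{1..k}\<close>: the absolute
  values of the exponents of the basis elements.

  Such a set of vectors is the set of nonnegative solutions of a linear Diophantine system, but the
  system never has to be written down. If three homomorphisms \<open>f\<close>, \<open>g\<close>, \<open>h\<close> into \<open>G\<close> agree modulo the
  abelian normal subgroup \<open>N\<close>, then \<open>u \<mapsto> f u (g u)\<^sup>-\<^sup>1 h u\<close> is a homomorphism as well
  (\<open>heap_mem_hom\<close>), because \<open>(g u)\<^sup>-\<^sup>1 h u\<close> and \<open>f v (g v)\<^sup>-\<^sup>1\<close> lie in \<open>N\<close> and commute. Applied to the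
  extensions of three solutions to \<open>G * F\<close>, which are the identity on \<open>G\<close> and trivial on the
  equations, it yields a fourth solution (\<open>solutions_heap\<close>). On exponent vectors this operation is
  \<open>z - x + y\<close>.

  A set of vectors of natural numbers that contains \<open>z + (y - x)\<close> whenever it contains \<open>x \<le> y\<close> and \<open>z\<close>
  consists of the sums of one of finitely many base vectors and arbitrarily many vectors from a
  finite set of periods; this is Dickson's lemma applied twice
  (\<open>hybrid_linear_if_closed_under_translation\<close>).

  Finally, the words for one choice of cosets and signs are obtained from a fixed word with
  placeholders by replacing the placeholder for each exponent by that many copies of \<open>a\<^sub>i\<close> or its
  inverse. An EDT0L system keeps all placeholders as nonterminals; one endomorphism per base vector
  and per period adds that vector to all exponents simultaneously, which is how a single rewriting
  mechanism can keep exponents at distant places of the word linearly related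
  (\<open>EDT0L_language_fill\<close>). The choice of cosets and signs is made by the first endomorphism, so that
  finite unions come for free.\<close>

section \<open>Sets of vectors generated by bases and periods\<close>

text \<open>Induction on the number of coordinates. For a new coordinate \<open>v\<close>, take a finite set \<open>B\<close> that
  dominates with respect to the old coordinates and a bound \<open>m\<close> for its entries at \<open>v\<close>. Then \<open>B\<close> also
  takes care of all \<open>x\<close> with \<open>x v \<ge> m\<close>, and on each of the finitely many remaining slices \<open>x v = c\<close>
  the new coordinate is constant.\<close>

lemma dickson:
  fixes A :: "('i \<Rightarrow> nat) set"
  assumes "finite V"
  shows "\<exists>B\<subseteq>A. finite B \<and> (\<forall>x\<in>A. \<exists>b\<in>B. \<forall>v\<in>V. b v \<le> x v)"
  using assms
proof (induction V arbitrary: A)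
  case empty
  show ?case
  proof (cases "A = {}")
    case False
    then obtain x where "x \<in> A" by blast
    then show ?thesis by (intro exI[of _ "{x}"]) auto
  qed auto
next
  case (insert v V)
  obtain B where B: "B \<subseteq> A" "finite B" "\<forall>x\<in>A. \<exists>b\<in>B. \<forall>u\<in>V. b u \<le> x u"
    using insert.IH[of A] by blast
  let ?dom = "\<lambda>c D. D \<subseteq> {x \<in> A. x v = c} \<and> finite D \<and>
    (\<forall>x\<in>A. x v = c \<longrightarrow> (\<exists>b\<in>D. \<forall>u\<in>V. b u \<le> x u))"
  have "\<forall>c. \<exists>D. ?dom c D"
  proof
    fix c show "\<exists>D. ?dom c D" using insert.IH[of "{x \<in> A. x v = c}"] by auto
  qed
  then have "\<exists>D. \<forall>c. ?dom c (D c)" by (rule choice)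
  then obtain D where "\<forall>c. ?dom c (D c)" ..
  then have D: "\<And>c. D c \<subseteq> {x \<in> A. x v = c}" "\<And>c. finite (D c)"
    "\<And>c. \<forall>x\<in>A. x v = c \<longrightarrow> (\<exists>b\<in>D c. \<forall>u\<in>V. b u \<le> x u)"
    by blast+
  obtain m where m: "\<And>b. b \<in> B \<Longrightarrow> b v \<le> m"
    using B(2) finite_nat_set_iff_bounded_le[of "(\<lambda>b. b v) ` B"] by auto
  let ?B = "B \<union> (\<Union>c<m. D c)"
  have "\<exists>b\<in>?B. \<forall>u\<in>insert v V. b u \<le> x u" if x: "x \<in> A" for x
  proof (cases "x v < m")
    case True
    obtain b where "b \<in> D (x v)" "\<forall>u\<in>V. b u \<le> x u" using D(3) x by blast
    with D(1)[of "x v"] True show ?thesis by (intro bexI[of _ b]) auto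
  next
    case False
    obtain b where "b \<in> B" "\<forall>u\<in>V. b u \<le> x u" using B(3) x by blast
    moreover from this have "b v \<le> x v" using m[of b] False by simp
    ultimately show ?thesis by auto
  qed
  moreover have "?B \<subseteq> A" using B(1) D(1) by blast
  moreover have "finite ?B" using B(2) D(2) by blast
  ultimately show ?case by blast
qed

text \<open>These are the hybrid linear sets, the semilinear sets in which all bases share the same
  periods. Sums range over words of periods rather than over coefficient vectors, because words of
  periods are what the control language of an EDT0L system spells.\<close>

definition hybrid_set :: "('i \<Rightarrow> nat) set \<Rightarrow> ('i \<Rightarrow> nat) set \<Rightarrow> ('i \<Rightarrow> nat) set" where
  "hybrid_set P Q = {p + sum_list qs | p qs. p \<in> P \<and> qs \<in> lists Q}"

definition hybrid_linear :: "('i \<Rightarrow> nat) set \<Rightarrow> bool" where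
  "hybrid_linear M \<longleftrightarrow> (\<exists>P Q. finite P \<and> finite Q \<and> M = hybrid_set P Q)"

text \<open>The vectors whose addition maps \<open>M\<close> into itself form the monoid \<open>D\<close> of periods. The hypothesis
  says that \<open>D\<close> contains all differences of comparable members of \<open>M\<close>. Dickson's lemma for \<open>M\<close> provides
  the bases; for the nonzero members of \<open>D\<close> it provides the generators of \<open>D\<close>, as every nonzero
  member lies above a generator and the difference is a smaller member.\<close>

theorem hybrid_linear_if_closed_under_translation:
  assumes V: "finite V" and supp: "\<And>x v. x \<in> M \<Longrightarrow> v \<notin> V \<Longrightarrow> x v = 0"
    and closed: "\<And>x y z. x \<in> M \<Longrightarrow> y \<in> M \<Longrightarrow> z \<in> M \<Longrightarrow> x \<le> y \<Longrightarrow> z + (y - x) \<in> M"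
  shows "hybrid_linear M"
proof (cases "M = {}")
  case True
  then show ?thesis unfolding hybrid_linear_def hybrid_set_def by (intro exI[of _ "{}"]) auto
next
  case False
  then obtain z0 where z0: "z0 \<in> M" by blast
  define D where "D = {d. (\<forall>v. v \<notin> V \<longrightarrow> d v = 0) \<and> (\<forall>z\<in>M. z + d \<in> M)}"
  have diff_M: "y - x \<in> D" if "x \<in> M" "y \<in> M" "x \<le> y" for x y
    using that supp[OF that(2)] closed[OF that(1,2) _ that(3)] unfolding D_def by auto
  \<comment> \<open>A difference of periods is a difference of members of \<open>M\<close>, namely of two translates of \<open>z0\<close>.\<close>
  have diff_D: "d - q \<in> D" if "d \<in> D" "q \<in> D" "q \<le> d" for d q
  proof -
    have "z0 + q \<in> M" "z0 + d \<in> M" using that z0 unfolding D_def by auto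
    moreover have "z0 + q \<le> z0 + d" using that(3) by (auto simp: le_fun_def)
    ultimately have "z0 + d - (z0 + q) \<in> D" by (rule diff_M)
    moreover have "z0 + d - (z0 + q) = d - q" by (auto simp: fun_eq_iff)
    ultimately show ?thesis by simp
  qed
  have below: "b \<le> x" if "\<forall>v\<in>V. b v \<le> x v" "\<forall>v. v \<notin> V \<longrightarrow> b v = 0" for b x :: "'a \<Rightarrow> nat"
  proof (rule le_funI)
    fix v show "b v \<le> x v" using that by (cases "v \<in> V") auto
  qed
  obtain P where P: "P \<subseteq> M" "finite P" "\<forall>x\<in>M. \<exists>p\<in>P. \<forall>v\<in>V. p v \<le> x v"
    using dickson[OF V, of M] by blast
  obtain Q where Q: "Q \<subseteq> D - {0}" "finite Q" "\<forall>x\<in>D - {0}. \<exists>q\<in>Q. \<forall>v\<in>V. q v \<le> x v"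
    using dickson[OF V, of "D - {0}"] by blast
  have gen: "\<exists>qs\<in>lists Q. d = sum_list qs" if "d \<in> D" for d
    using that
  proof (induction "\<Sum>v\<in>V. d v" arbitrary: d rule: less_induct)
    case less
    show ?case
    proof (cases "d = 0")
      case True
      then show ?thesis by (intro bexI[of _ "[]"]) auto
    next
      case False
      then obtain q where q: "q \<in> Q" "\<forall>v\<in>V. q v \<le> d v" using Q(3) less.prems by blast
      then have qD: "q \<in> D" "q \<noteq> 0" using Q(1) by auto
      then have le: "q \<le> d" using q(2) by (intro below) (auto simp: D_def)
      obtain v where v: "q v \<noteq> 0" using qD(2) by (auto simp: fun_eq_iff)
      then have "v \<in> V" using qD(1) by (auto simp: D_def)
      moreover from this have "(d - q) v < d v" using v q(2) by force
      moreover have "(d - q) u \<le> d u" for u by simp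
      ultimately have "(\<Sum>v\<in>V. (d - q) v) < (\<Sum>v\<in>V. d v)"
        by (intro sum_strict_mono_ex1[OF V]) auto
      then obtain qs where qs: "qs \<in> lists Q" "d - q = sum_list qs"
        using less.hyps diff_D[OF less.prems qD(1) le] by blast
      have "d = q + (d - q)" using le by (auto simp: fun_eq_iff le_fun_def)
      then have "d = sum_list (q # qs)" using qs(2) by simp
      then show ?thesis using qs(1) q(1) by (intro bexI[of _ "q # qs"]) auto
    qed
  qed
  have "x \<in> hybrid_set P Q" if x: "x \<in> M" for x
  proof -
    obtain p where p: "p \<in> P" "\<forall>v\<in>V. p v \<le> x v" using P(3) x by blast
    then have le: "p \<le> x" using supp P(1) by (intro below) auto
    obtain qs where "qs \<in> lists Q" "x - p = sum_list qs" using gen diff_M[of p x] p P(1) x le by blast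
    moreover have "x = p + (x - p)" using le by (auto simp: fun_eq_iff le_fun_def)
    ultimately show ?thesis using p(1) unfolding hybrid_set_def by auto
  qed
  moreover have "z + sum_list qs \<in> M" if "qs \<in> lists Q" "z \<in> M" for qs z
    using that
  proof (induction qs arbitrary: z)
    case (Cons q qs)
    then have zq: "z + q \<in> M" using Q(1) unfolding D_def by blast
    have "z + q + sum_list qs \<in> M" by (rule Cons.IH[OF zq])
    then show ?case by (simp only: sum_list.Cons add.assoc)
  qed simp
  ultimately have "M = hybrid_set P Q" using P(1) unfolding hybrid_set_def by blast
  then show ?thesis unfolding hybrid_linear_def using P(2) Q(2) by blast
qed

section \<open>EDT0L languages from patterns with linearly related exponents\<close>

lemma regular_language_letters:
  assumes "finite F" "F \<subseteq> E"
  shows "regular_language E ((\<lambda>x. [x]) ` F)"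
  using assms
proof (induction F)
  case (insert x F)
  then have "regular_language E ({[x]} \<union> (\<lambda>x. [x]) ` F)"
    by (intro regular_language.intros) auto
  then show ?case by simp
qed (simp add: regular_language.intros)

lemma regular_language_lists:
  assumes "finite F" "F \<subseteq> E"
  shows "regular_language E (lists F)"
proof -
  have "{concat us | us. us \<in> lists ((\<lambda>x. [x]) ` F)} = lists F"
  proof (intro equalityI subsetI)
    fix u assume "u \<in> lists F"
    then have "map (\<lambda>x. [x]) u \<in> lists ((\<lambda>x. [x]) ` F)" "u = concat (map (\<lambda>x. [x]) u)" by auto
    then show "u \<in> {concat us | us. us \<in> lists ((\<lambda>x. [x]) ` F)}" by blast
  qed (auto simp: lists_image)
  then show ?thesis using regular_language.intros(6)[OF regular_language_letters[OF assms]] by simp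
qed

lemma regular_language_UN:
  assumes "finite J" "\<And>j. j \<in> J \<Longrightarrow> regular_language E (K j)"
  shows "regular_language E (\<Union>j\<in>J. K j)"
  using assms by (induction J) (auto intro: regular_language.intros)

text \<open>The shape of the control words below: set up a pattern, add one base, add any periods, clean up.\<close>

lemma regular_language_framed_lists:
  assumes "finite A" "finite B" "insert s (insert e (A \<union> B)) \<subseteq> E"
  shows "regular_language E {s # x # us @ [e] | x us. x \<in> A \<and> us \<in> lists B}"
proof -
  let ?cat = "\<lambda>K L. {u @ v | u v. u \<in> K \<and> v \<in> L}"
  have "regular_language E (?cat {[s]} (?cat ((\<lambda>x. [x]) ` A) (?cat (lists B) {[e]})))"
    using assms
    by (intro regular_language.intros regular_language_letters regular_language_lists) auto
  also have "?cat (lists B) {[e]} = {us @ [e] | us. us \<in> lists B}" by simp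
  also have "?cat ((\<lambda>x. [x]) ` A) {us @ [e] | us. us \<in> lists B} =
      {x # us @ [e] | x us. x \<in> A \<and> us \<in> lists B}" (is "?L = ?R")
  proof (intro equalityI subsetI)
    fix w assume "w \<in> ?R"
    then obtain x us where "w = [x] @ us @ [e]" "[x] \<in> (\<lambda>x. [x]) ` A"
      "us @ [e] \<in> {us @ [e] | us. us \<in> lists B}" by auto
    then show "w \<in> ?L" by blast
  qed auto
  also have "?cat {[s]} {x # us @ [e] | x us. x \<in> A \<and> us \<in> lists B} =
      {s # x # us @ [e] | x us. x \<in> A \<and> us \<in> lists B}" by auto
  finally show ?thesis .
qed

lemma concat_map_in_hom_free_monoid:
  assumes "\<And>z. z \<in> C \<Longrightarrow> set (f z) \<subseteq> C"
  shows "(\<lambda>u. concat (map f u)) \<in> hom (free_monoid C) (free_monoid C)"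
  using assms by (fastforce simp: free_monoid_def hom_def)

text \<open>A letter \<open>Inr v\<close> of the last argument is a placeholder for a power of the letter \<open>b v\<close>.\<close>

definition fill :: "('i \<Rightarrow> 'l) \<Rightarrow> ('i \<Rightarrow> nat) \<Rightarrow> ('l + 'i) list \<Rightarrow> 'l list" where
  "fill b x p = concat (map (case_sum (\<lambda>c. [c]) (\<lambda>v. replicate (x v) (b v))) p)"

text \<open>The nonterminals are a start letter \<open>Inr 0\<close> and a letter \<open>Inr (Suc (enc v))\<close> for every
  placeholder \<open>v\<close>; they are shared by all members \<open>j\<close> of the family. The control words for \<open>j\<close> are:
  replace the start letter by the pattern, add one base, add any word of periods, and erase the
  nonterminals. Before the erasure the word is always \<open>pending (b j) x (pat j)\<close> for the vector \<open>x\<close>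
  accumulated so far, in which every placeholder survives behind the power that it has produced.\<close>

theorem EDT0L_language_fill:
  fixes \<Omega> :: "'l set" and V :: "'i set" and pat :: "'j \<Rightarrow> ('l + 'i) list"
  assumes fin: "finite \<Omega>" "finite V" "finite J"
    and pat: "\<And>j. j \<in> J \<Longrightarrow> set (pat j) \<subseteq> \<Omega> <+> V"
    and b: "\<And>j v. j \<in> J \<Longrightarrow> v \<in> V \<Longrightarrow> b j v \<in> \<Omega>"
    and M: "\<And>j. j \<in> J \<Longrightarrow> hybrid_linear (M j)"
  shows "EDT0L_language \<Omega> (\<Union>j\<in>J. {fill (b j) x (pat j) | x. x \<in> M j})"
proof -
  obtain P Q where PQ: "\<And>j. j \<in> J \<Longrightarrow> finite (P j)" "\<And>j. j \<in> J \<Longrightarrow> finite (Q j)"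
    "\<And>j. j \<in> J \<Longrightarrow> M j = hybrid_set (P j) (Q j)"
    using M unfolding hybrid_linear_def by metis
  obtain enc :: "'i \<Rightarrow> nat" where enc: "inj_on enc V"
    using finite_imp_inj_to_nat_seg[OF fin(2)] by blast
  \<comment> \<open>Nonterminals are natural numbers, hence the coding of placeholders; only codes of members
    of \<open>V\<close> occur in \<open>C\<close>, and the value of \<open>dec\<close> elsewhere is arbitrary.\<close>
  define dec where "dec = inv_into V enc"
  have dec: "dec (enc v) = v" if "v \<in> V" for v using enc that by (simp add: dec_def)
  define C :: "('l + nat) set" where "C = Inl ` \<Omega> \<union> insert (Inr 0) ((\<lambda>v. Inr (Suc (enc v))) ` V)"
  define pending :: "('i \<Rightarrow> 'l) \<Rightarrow> ('i \<Rightarrow> nat) \<Rightarrow> ('l + 'i) list \<Rightarrow> ('l + nat) list" where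
    "pending = (\<lambda>b x p. concat (map (case_sum (\<lambda>c. [Inl c])
      (\<lambda>v. replicate (x v) (Inl (b v)) @ [Inr (Suc (enc v))])) p))"
  define start where
    "start = (\<lambda>j z. case z of Inr 0 \<Rightarrow> pending (b j) 0 (pat j) | _ \<Rightarrow> [z])"
  define grow :: "('i \<Rightarrow> 'l) \<Rightarrow> ('i \<Rightarrow> nat) \<Rightarrow> 'l + nat \<Rightarrow> ('l + nat) list" where
    "grow = (\<lambda>b q z. case z of
      Inr (Suc m) \<Rightarrow> replicate (q (dec m)) (Inl (b (dec m))) @ [z] | _ \<Rightarrow> [z])"
  define stop :: "'l + nat \<Rightarrow> ('l + nat) list" where
    "stop = (\<lambda>z. case z of Inl c \<Rightarrow> [z] | Inr m \<Rightarrow> [])"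
  define hm :: "('l + nat \<Rightarrow> ('l + nat) list) \<Rightarrow> ('l + nat) list \<Rightarrow> ('l + nat) list"
    where "hm = (\<lambda>f u. concat (map f u))"
  define E where "E = insert (hm stop)
    ((\<Union>j\<in>J. insert (hm (start j)) ((\<lambda>q. hm (grow (b j) q)) ` (P j \<union> Q j))))"
  let ?g = "\<lambda>j q. hm (grow (b j) q)"
  define K where "K = (\<Union>j\<in>J. {hm (start j) # \<phi> # \<phi>s @ [hm stop] | \<phi> \<phi>s.
    \<phi> \<in> ?g j ` P j \<and> \<phi>s \<in> lists (?g j ` Q j)})"
  \<comment> \<open>Terminals are fixed by \<open>grow\<close>, so the copies it inserts line up with those already present.\<close>
  have grow_pending: "hm (grow b' q) (pending b' x p) = pending b' (x + q) p"
    if "set p \<subseteq> \<Omega> <+> V" for b' q x p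
    using that
  proof (induction p)
    case (Cons z p)
    have r: "concat (map (grow b' q) (replicate n (Inl c))) = replicate n (Inl c)" for n c
      by (induction n) (auto simp: grow_def)
    show ?case using Cons
      by (auto simp: pending_def hm_def r grow_def dec replicate_add[symmetric] add.commute)
  qed (simp add: pending_def hm_def)
  have stop_pending: "hm stop (pending b' x p) = map Inl (fill b' x p)" for b' x p
  proof (induction p)
    case (Cons z p)
    have r: "concat (map stop (replicate n (Inl c))) = replicate n (Inl c)" for n c
      by (induction n) (auto simp: stop_def)
    show ?case using Cons
      by (cases z) (auto simp: pending_def hm_def fill_def r stop_def)
  qed (simp add: pending_def hm_def fill_def)
  have fold_grow: "fold (\<lambda>\<phi>. \<phi>) (map (\<lambda>q. hm (grow b' q)) qs) (pending b' x p) =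
      pending b' (x + sum_list qs) p" if "set p \<subseteq> \<Omega> <+> V" for b' qs x p
    using that by (induction qs arbitrary: x) (simp_all add: grow_pending add.assoc)
  have spell: "fold (\<lambda>\<phi>. \<phi>) (hm (start j) # ?g j p # map (?g j) qs @ [hm stop]) [Inr 0] =
      map Inl (fill (b j) (p + sum_list qs) (pat j))" if "j \<in> J" for j p qs
  proof -
    have "hm (start j) [Inr 0] = pending (b j) 0 (pat j)" by (simp add: hm_def start_def)
    then show ?thesis
      by (simp add: grow_pending fold_grow stop_pending pat[OF that])
  qed
  have accepted: "map Inl ` (\<Union>j\<in>J. {fill (b j) x (pat j) | x. x \<in> M j}) =
      EDT0L_accepted [Inr 0] (fold (\<lambda>\<phi>. \<phi>) ` K)"
  proof (intro equalityI subsetI)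
    fix u :: "('l + nat) list" assume "u \<in> map Inl ` (\<Union>j\<in>J. {fill (b j) x (pat j) | x. x \<in> M j})"
    then obtain j p qs where *: "j \<in> J" "p \<in> P j" "qs \<in> lists (Q j)"
      "u = map Inl (fill (b j) (p + sum_list qs) (pat j))" using PQ(3) unfolding hybrid_set_def by auto
    let ?k = "hm (start j) # ?g j p # map (?g j) qs @ [hm stop]"
    have "map (?g j) qs \<in> lists (?g j ` Q j)" using *(3) by auto
    then have "?k \<in> K" unfolding K_def using *(1,2) by blast
    moreover have "u = fold (\<lambda>\<phi>. \<phi>) ?k [Inr 0]" using spell[OF *(1)] *(4) by simp
    ultimately show "u \<in> EDT0L_accepted [Inr 0] (fold (\<lambda>\<phi>. \<phi>) ` K)"
      unfolding EDT0L_accepted_def by blast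
  next
    fix u assume "u \<in> EDT0L_accepted [Inr 0] (fold (\<lambda>\<phi>. \<phi>) ` K)"
    then obtain \<kappa> where "\<kappa> \<in> K" and u: "u = fold (\<lambda>\<phi>. \<phi>) \<kappa> [Inr 0]"
      unfolding EDT0L_accepted_def by blast
    then obtain j p \<phi>s where *: "j \<in> J" "p \<in> P j" "\<phi>s \<in> lists (?g j ` Q j)"
      "\<kappa> = hm (start j) # ?g j p # \<phi>s @ [hm stop]" unfolding K_def by blast
    then obtain qs where "qs \<in> lists (Q j)" "\<phi>s = map (?g j) qs"
      unfolding lists_image by blast
    then have "u = map Inl (fill (b j) (p + sum_list qs) (pat j))" "p + sum_list qs \<in> M j"
      using * spell[OF *(1), of p qs] PQ(3)[OF *(1)] unfolding u hybrid_set_def by blast+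
    then show "u \<in> map Inl ` (\<Union>j\<in>J. {fill (b j) x (pat j) | x. x \<in> M j})"
      using *(1) by blast
  qed
  have endo: "hm f \<in> hom (free_monoid C) (free_monoid C)"
    if "\<And>z. z \<in> C \<Longrightarrow> set (f z) \<subseteq> C" for f
    unfolding hm_def by (rule concat_map_in_hom_free_monoid) (rule that)
  have "hm stop \<in> hom (free_monoid C) (free_monoid C)"
    by (rule endo) (auto simp: stop_def C_def)
  moreover have "hm (start j) \<in> hom (free_monoid C) (free_monoid C)" if j: "j \<in> J" for j
  proof (rule endo)
    have "set (pending (b j) 0 (pat j)) \<subseteq> C"
      using pat[OF j] by (fastforce simp: pending_def C_def)
    then show "set (start j z) \<subseteq> C" if "z \<in> C" for z
      using that by (auto simp: start_def split: sum.split nat.split)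
  qed
  moreover have "hm (grow (b j) q) \<in> hom (free_monoid C) (free_monoid C)" if j: "j \<in> J" for j q
    by (rule endo) (use b[OF j] in \<open>auto simp: grow_def C_def dec\<close>)
  ultimately have E_hom: "E \<subseteq> hom (free_monoid C) (free_monoid C)" unfolding E_def by blast
  have E_fin: "finite E" unfolding E_def using fin PQ by blast
  have "regular_language E K" unfolding K_def
    by (intro regular_language_UN fin regular_language_framed_lists)
      (use PQ in \<open>auto simp: E_def\<close>)
  then have reg: "regular_endomorphism_set C (fold (\<lambda>\<phi>. \<phi>) ` K)"
    unfolding regular_endomorphism_set_def using E_fin E_hom by blast
  have over: "\<phi> [Inr 0] \<in> lists (Inl ` \<Omega>)" if "\<phi> \<in> fold (\<lambda>\<phi>. \<phi>) ` K" for \<phi>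
  proof -
    have "\<phi> [Inr 0] \<in> map Inl ` (\<Union>j\<in>J. {fill (b j) x (pat j) | x. x \<in> M j})"
      using that unfolding accepted EDT0L_accepted_def by blast
    then obtain j x where j: "j \<in> J" "\<phi> [Inr 0] = map Inl (fill (b j) x (pat j))" by blast
    have "set (fill (b j) x (pat j)) \<subseteq> \<Omega>"
      using pat[OF j(1)] b[OF j(1)] by (fastforce simp: fill_def)
    then show ?thesis using j(2) by (auto intro!: imageI)
  qed
  have "EDT0L_system (Inl ` \<Omega>) C [Inr 0] (fold (\<lambda>\<phi>. \<phi>) ` K)"
    unfolding EDT0L_system_def using reg over fin by (auto simp: C_def)
  then show ?thesis unfolding EDT0L_language_def using accepted by blast
qed

section \<open>Solutions in groups with an abelian normal subgroup\<close>

lemma presented_monoid_hom_eqI: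
  assumes "group (presented_monoid A R)" "group H"
    and f: "f \<in> hom (presented_monoid A R) H" and g: "g \<in> hom (presented_monoid A R) H"
    and eq: "\<And>x. x \<in> A \<Longrightarrow> f (word_class A R [x]) = g (word_class A R [x])"
    and w: "w \<in> carrier (presented_monoid A R)"
  shows "f w = g w"
proof -
  have "f (word_class A R u) = g (word_class A R u)" if "u \<in> lists A" for u
    using that
  proof (induction u)
    case Nil
    show ?case using hom_one[OF f assms(1,2)] hom_one[OF g assms(1,2)]
      by (simp add: one_presented_monoid)
  next
    case (Cons x u)
    then have l: "[x] \<in> lists A" "u \<in> lists A" by auto
    show ?case
      using mult_presented_monoid[OF l, of R] hom_mult[OF f] hom_mult[OF g] word_class_closed l
        eq[of x] Cons by (metis append_Cons append_Nil)
  qed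
  then show ?thesis using w unfolding carrier_presented_monoid by blast
qed

lemma free_group_hom_eqI:
  assumes H: "group H" and f: "f \<in> hom (free_group V) H" and g: "g \<in> hom (free_group V) H"
    and eq: "\<And>x. x \<in> V \<Longrightarrow> f (free_gen V x) = g (free_gen V x)"
    and w: "w \<in> carrier (free_group V)"
  shows "f w = g w"
proof -
  let ?A = "V \<times> (UNIV :: bool set)" and ?R = "free_group_rels V"
  interpret F: group "free_group V" by (rule group_free_group)
  interpret f: group_hom "free_group V" H f
    by (intro group_hom.intro group_hom_axioms.intro group_free_group H f)
  interpret g: group_hom "free_group V" H g
    by (intro group_hom.intro group_hom_axioms.intro group_free_group H g)
  have inv_gen: "word_class ?A ?R [(x, False)] = inv\<^bsub>free_group V\<^esub> free_gen V x" if "x \<in> V" for x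
  proof -
    have l: "[(x, False)] \<in> lists ?A" "[(x, True)] \<in> lists ?A" using that by auto
    have "([(x, False), (x, True)], []) \<in> ?R" using that unfolding free_group_rels_def by force
    from word_cong.rel[OF this, of "[]" "[]" ?A]
    have "([(x, False), (x, True)], []) \<in> word_cong ?A ?R" using that by auto
    then have "word_class ?A ?R [(x, False)] \<otimes>\<^bsub>free_group V\<^esub> free_gen V x = \<one>\<^bsub>free_group V\<^esub>"
      unfolding free_group_def free_gen_def mult_presented_monoid[OF l] one_presented_monoid
      using that by (subst word_class_eq_iff) auto
    moreover have "word_class ?A ?R [(x, False)] \<in> carrier (free_group V)"
      "free_gen V x \<in> carrier (free_group V)"
      unfolding free_group_def free_gen_def by (rule word_class_closed[OF l(1)] word_class_closed[OF l(2)])+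
    ultimately show ?thesis by (metis F.inv_equality)
  qed
  have gen: "free_gen V x \<in> carrier (free_group V)" if "x \<in> V" for x
    unfolding free_group_def free_gen_def by (rule word_class_closed) (use that in auto)
  have "f (word_class ?A ?R [z]) = g (word_class ?A ?R [z])" if "z \<in> ?A" for z
  proof -
    obtain x c where z: "z = (x, c)" "x \<in> V" using \<open>z \<in> ?A\<close> by auto
    show ?thesis
    proof (cases c)
      case True
      then show ?thesis using eq z by (simp add: free_gen_def)
    next
      case False
      then show ?thesis using eq z by (simp add: inv_gen gen)
    qed
  qed
  then show ?thesis
    using presented_monoid_hom_eqI[of ?A ?R H f g w] F.is_group H f g w unfolding free_group_def by blast
qed

lemma free_product_hom_eqI:
  assumes "group K" "group L" and H: "group H"
    and f: "f \<in> hom (free_product K L) H" and g: "g \<in> hom (free_product K L) H"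
    and l: "\<And>x. x \<in> carrier K \<Longrightarrow> f (free_product_inl K L x) = g (free_product_inl K L x)"
    and r: "\<And>y. y \<in> carrier L \<Longrightarrow> f (free_product_inr K L y) = g (free_product_inr K L y)"
    and w: "w \<in> carrier (free_product K L)"
  shows "f w = g w"
proof (rule presented_monoid_hom_eqI)
  show "group (presented_monoid (carrier K <+> carrier L) (free_product_rels K L))"
    using group_free_product[OF assms(1,2)] unfolding free_product_def .
qed (use H f g w l r in \<open>auto simp: free_product_def free_product_inl_def free_product_inr_def\<close>)

text \<open>Writing \<open>c = f v (g v)\<^sup>-\<^sup>1\<close> and \<open>d' = (g u)\<^sup>-\<^sup>1 h u\<close>, the value at \<open>u v\<close> is \<open>f u c d' h v\<close> and the
  product of the values at \<open>u\<close> and \<open>v\<close> is \<open>f u d' c h v\<close>. Both \<open>c\<close> and \<open>d'\<close> lie in the abelian subgroup \<open>H\<close>,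
  the former directly and the latter by normality.\<close>

lemma (in normal) heap_mem_hom:
  assumes comm: "\<And>x y. x \<in> H \<Longrightarrow> y \<in> H \<Longrightarrow> x \<otimes> y = y \<otimes> x"
    and f: "f \<in> hom K G" and g: "g \<in> hom K G" and h: "h \<in> hom K G"
    and fg: "\<And>u. u \<in> carrier K \<Longrightarrow> H #> f u = H #> g u"
    and gh: "\<And>u. u \<in> carrier K \<Longrightarrow> H #> g u = H #> h u"
  shows "(\<lambda>u. f u \<otimes> inv (g u) \<otimes> h u) \<in> hom K G"
proof (rule homI)
  have cl: "f u \<in> carrier G" "g u \<in> carrier G" "h u \<in> carrier G" if "u \<in> carrier K" for u
    using f g h that by (auto intro: hom_in_carrier)
  then show "f u \<otimes> inv (g u) \<otimes> h u \<in> carrier G" if "u \<in> carrier K" for u using that by simp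
  fix u v assume u: "u \<in> carrier K" and v: "v \<in> carrier K"
  obtain c where c: "c \<in> H" "f v = c \<otimes> g v"
    using fg[OF v] rcos_self[OF cl(1)[OF v] subgroup_axioms] by (auto simp: r_coset_def)
  obtain d where d: "d \<in> H" "h u = d \<otimes> g u"
    using gh[OF u] rcos_self[OF cl(3)[OF u] subgroup_axioms] by (auto simp: r_coset_def)
  define d' where "d' = inv (g u) \<otimes> d \<otimes> g u"
  have d': "d' \<in> H" unfolding d'_def using cl(2)[OF u] d(1) by (rule inv_op_closed1)
  have C: "c \<in> carrier G" "d \<in> carrier G" "d' \<in> carrier G" using c d d' mem_carrier by auto
  note [simp] = cl[OF u] cl[OF v] C
  have hu: "h u = g u \<otimes> d'" unfolding d'_def d(2) by (simp add: m_assoc[symmetric])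
  have can: "x \<otimes> (inv x \<otimes> y) = y" "inv x \<otimes> (x \<otimes> y) = y" if "x \<in> carrier G" "y \<in> carrier G" for x y
    using that by (simp_all add: m_assoc[symmetric])
  have "f (u \<otimes>\<^bsub>K\<^esub> v) \<otimes> inv (g (u \<otimes>\<^bsub>K\<^esub> v)) \<otimes> h (u \<otimes>\<^bsub>K\<^esub> v) =
      f u \<otimes> f v \<otimes> inv (g u \<otimes> g v) \<otimes> (h u \<otimes> h v)"
    using hom_mult[OF f u v] hom_mult[OF g u v] hom_mult[OF h u v] by simp
  also have "\<dots> = f u \<otimes> (c \<otimes> d') \<otimes> h v"
    unfolding c(2) hu by (simp add: inv_mult_group m_assoc can)
  also have "c \<otimes> d' = d' \<otimes> c" using comm c(1) d' by blast
  also have "f u \<otimes> (d' \<otimes> c) \<otimes> h v = (f u \<otimes> inv (g u) \<otimes> h u) \<otimes> (f v \<otimes> inv (g v) \<otimes> h v)"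
    unfolding c(2) hu by (simp add: inv_mult_group m_assoc can)
  finally show "f (u \<otimes>\<^bsub>K\<^esub> v) \<otimes> inv (g (u \<otimes>\<^bsub>K\<^esub> v)) \<otimes> h (u \<otimes>\<^bsub>K\<^esub> v) =
      (f u \<otimes> inv (g u) \<otimes> h u) \<otimes> (f v \<otimes> inv (g v) \<otimes> h v)" .
qed

text \<open>Agreement modulo \<open>H\<close> is only assumed on the free generators. It passes to the free group, and from
  there to the extensions on the free product, since homomorphisms into the quotient group are
  determined by their values on generators and the extensions coincide on \<open>G\<close>.\<close>

lemma (in normal) solutions_heap:
  assumes comm: "\<And>x y. x \<in> H \<Longrightarrow> y \<in> H \<Longrightarrow> x \<otimes> y = y \<otimes> x"
    and S: "S \<subseteq> carrier (free_product G (free_group V))"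
    and f: "f \<in> solutions G V S" and g: "g \<in> solutions G V S" and h: "h \<in> solutions G V S"
    and fg: "\<And>x. x \<in> V \<Longrightarrow> H #> f (free_gen V x) = H #> g (free_gen V x)"
    and gh: "\<And>x. x \<in> V \<Longrightarrow> H #> g (free_gen V x) = H #> h (free_gen V x)"
  shows "(\<lambda>u. f u \<otimes> inv (g u) \<otimes> h u) \<in> solutions G V S"
proof -
  let ?F = "free_group V" and ?P = "free_product G (free_group V)"
  have Q: "group (G Mod H)" by (rule factorgroup_is_group)
  obtain f' g' h' where
    f': "f \<in> hom ?F G" "extends_by_identity G V f f'" "\<forall>w\<in>S. f' w = \<one>" and
    g': "g \<in> hom ?F G" "extends_by_identity G V g g'" "\<forall>w\<in>S. g' w = \<one>" and
    h': "h \<in> hom ?F G" "extends_by_identity G V h h'" "\<forall>w\<in>S. h' w = \<one>"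
    using f g h unfolding solutions_def by blast
  have cos_hom: "(\<lambda>u. H #> k u) \<in> hom K (G Mod H)" if "k \<in> hom K G" for k and K :: "('k, 'e) monoid_scheme"
    using Group.hom_compose[OF that r_coset_hom_Mod] by (simp add: comp_def)
  have F_eq: "H #> k u = H #> l u" if "k \<in> hom ?F G" "l \<in> hom ?F G" "u \<in> carrier ?F"
    "\<And>x. x \<in> V \<Longrightarrow> H #> k (free_gen V x) = H #> l (free_gen V x)" for k l u
    using free_group_hom_eqI[OF Q cos_hom cos_hom, of k V l] that by blast
  have P_eq: "H #> k' u = H #> l' u"
    if "extends_by_identity G V k k'" "extends_by_identity G V l l'" "u \<in> carrier ?P"
    "\<And>u. u \<in> carrier ?F \<Longrightarrow> H #> k u = H #> l u" for k l k' l' u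
    using free_product_hom_eqI[OF is_group group_free_group Q cos_hom cos_hom, of k' V l'] that
    unfolding extends_by_identity_def by auto
  have "(\<lambda>u. f u \<otimes> inv (g u) \<otimes> h u) \<in> hom ?F G"
    using comm f'(1) g'(1) h'(1) by (rule heap_mem_hom) (use F_eq f' g' h' fg gh in blast)+
  moreover have "(\<lambda>u. f' u \<otimes> inv (g' u) \<otimes> h' u) \<in> hom ?P G"
  proof (rule heap_mem_hom[OF comm])
    show "f' \<in> hom ?P G" "g' \<in> hom ?P G" "h' \<in> hom ?P G"
      using f' g' h' by (auto simp: extends_by_identity_def)
  qed (use P_eq F_eq f' g' h' fg gh in blast)+
  then have "extends_by_identity G V (\<lambda>u. f u \<otimes> inv (g u) \<otimes> h u) (\<lambda>u. f' u \<otimes> inv (g' u) \<otimes> h' u)"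
    using f'(2) g'(2) h'(2) unfolding extends_by_identity_def by (simp add: r_inv)
  moreover have "\<forall>w\<in>S. f' w \<otimes> inv (g' w) \<otimes> h' w = \<one>" using f' g' h' by simp
  ultimately show ?thesis unfolding solutions_def by blast
qed

section \<open>Normal forms and exponent vectors\<close>

lemma concat_map_hash_join:
  assumes "f Hash = [Hash]" "\<And>z. f (Letter z) = map Letter (g z)"
  shows "concat (map f (hash_join us)) = hash_join (map (\<lambda>u. concat (map g u)) us)"
proof -
  have "concat (map f (map Letter u)) = map Letter (concat (map g u))" for u
    by (induction u) (simp_all add: assms(2))
  then show ?thesis
    by (induction us rule: hash_join.induct) (simp_all add: assms(1) del: map_map)
qed

lemma set_hash_join: "set (hash_join us) \<subseteq> insert Hash (Letter ` (\<Union>u\<in>set us. set u))"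
  by (induction us rule: hash_join.induct) auto

lemma (in group) normal_element_cong:
  "(\<And>i. i \<in> {1..k} \<Longrightarrow> d i = e i) \<Longrightarrow> normal_element G k a d t = normal_element G k a e t"
  unfolding normal_element_def by (rule foldr_cong) auto

text \<open>The map \<open>\<nu>\<close> is \<open>e \<mapsto> a\<^sub>1^e\<^sub>1 \<dots> a\<^sub>k^e\<^sub>k\<close>; through it, all computations with normal forms in one coset
  become computations with exponent vectors.\<close>

lemma (in group) free_abelian_basis_translation:
  assumes N: "subgroup N G" and a: "free_abelian_basis G N k a"
  obtains \<nu> where "\<And>e. \<nu> e \<in> N" "\<And>d e. \<nu> (\<lambda>i. d i + e i) = \<nu> d \<otimes> \<nu> e"
    "\<And>e t. t \<in> carrier G \<Longrightarrow> normal_element G k a e t = \<nu> e \<otimes> t"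
proof -
  let ?F = "free_Abelian_group {1..k}" and ?s = "\<lambda>e. \<Sum>i=1..k. frag_cmul (e i) (frag_of i)"
  obtain \<phi> where hom: "\<phi> \<in> hom ?F (G\<lparr>carrier := N\<rparr>)" and \<phi>a: "\<And>i. i \<in> {1..k} \<Longrightarrow> \<phi> (frag_of i) = a i"
    using a unfolding free_abelian_basis_def iso_def by blast
  have s: "?s e \<in> carrier ?F" for e unfolding carrier_free_Abelian_group_iff by (rule keys_sum_frag)
  show ?thesis
  proof (rule that[of "\<lambda>e. \<phi> (?s e)"])
    show "\<phi> (?s e) \<in> N" for e using hom_in_carrier[OF hom s] by simp
    have "?s (\<lambda>i. d i + e i) = ?s d + ?s e" for d e
      by (simp add: frag_cmul_distrib sum.distrib)
    then show "\<phi> (?s (\<lambda>i. d i + e i)) = \<phi> (?s d) \<otimes> \<phi> (?s e)" for d e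
      using hom_mult[OF hom s s] by simp
  qed (rule normal_element_eq[OF N hom \<phi>a])
qed

lemma (in group) normal_element_heap:
  assumes N: "subgroup N G" and a: "free_abelian_basis G N k a" and t: "t \<in> carrier G"
  shows "normal_element G k a c t \<otimes> inv (normal_element G k a d t) \<otimes> normal_element G k a e t =
    normal_element G k a (\<lambda>i. c i - d i + e i) t"
proof -
  obtain \<nu> where \<nu>: "\<And>e. \<nu> e \<in> N" "\<And>d e. \<nu> (\<lambda>i. d i + e i) = \<nu> d \<otimes> \<nu> e"
    "\<And>e t. t \<in> carrier G \<Longrightarrow> normal_element G k a e t = \<nu> e \<otimes> t"
    using free_abelian_basis_translation[OF N a] by blast
  have G: "\<nu> e \<in> carrier G" for e using subgroup.mem_carrier[OF N \<nu>(1)] .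
  have "\<nu> c = \<nu> (\<lambda>i. c i - d i) \<otimes> \<nu> d" using \<nu>(2)[of "\<lambda>i. c i - d i" d] by simp
  then have "\<nu> c \<otimes> t = \<nu> (\<lambda>i. c i - d i) \<otimes> (\<nu> d \<otimes> t)" using G t by (simp add: m_assoc)
  then have "\<nu> c \<otimes> t \<otimes> inv (\<nu> d \<otimes> t) = \<nu> (\<lambda>i. c i - d i)" using G t by (simp add: m_assoc)
  then show ?thesis using \<nu>(2)[of "\<lambda>i. c i - d i" e] G t by (simp add: \<nu>(3) m_assoc)
qed

lemma (in group) normal_element_rcos:
  assumes N: "subgroup N G" and a: "free_abelian_basis G N k a" and t: "t \<in> carrier G"
  shows "N #> normal_element G k a e t = N #> t"
proof -
  obtain \<nu> where "\<nu> e \<in> N" "normal_element G k a e t = \<nu> e \<otimes> t"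
    using free_abelian_basis_translation[OF N a] t by metis
  then have "normal_element G k a e t \<in> N #> t" by (auto simp: r_coset_def)
  from repr_independence[OF this t N] show ?thesis by simp
qed

lemma (in group) free_abelian_basis_commute:
  assumes "free_abelian_basis G N k a" "x \<in> N" "y \<in> N"
  shows "x \<otimes> y = y \<otimes> x"
proof -
  let ?F = "free_Abelian_group {1..k}"
  obtain \<phi> where "\<phi> \<in> iso ?F (G\<lparr>carrier := N\<rparr>)"
    using assms(1) unfolding free_abelian_basis_def by blast
  then have hom: "\<phi> \<in> hom ?F (G\<lparr>carrier := N\<rparr>)" and surj: "\<phi> ` carrier ?F = N"
    by (auto simp: iso_def bij_betw_def)
  obtain c d where "c \<in> carrier ?F" "x = \<phi> c" "d \<in> carrier ?F" "y = \<phi> d"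
    using surj assms(2,3) by blast
  then show ?thesis
    using hom_mult[OF hom, of c d] hom_mult[OF hom, of d c] by (simp add: add.commute)
qed

lemma (in group) finite_right_transversal:
  assumes N: "subgroup N G" "finite (rcosets N)" and T: "right_transversal G N T"
  shows "finite T"
proof (rule inj_on_finite[of "\<lambda>t. N #> t"])
  have TG: "t \<in> carrier G" if "t \<in> T" for t using T that by (auto simp: right_transversal_def)
  show rc: "(\<lambda>t. N #> t) ` T \<subseteq> rcosets N"
    using TG subgroup.subset[OF N(1)] by (auto intro: rcosetsI)
  show "inj_on (\<lambda>t. N #> t) T"
  proof (rule inj_onI)
    fix t u assume tu: "t \<in> T" "u \<in> T" "N #> t = N #> u"
    then have "t \<in> N #> t" "u \<in> N #> t" using rcos_self[OF TG N(1)] by auto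
    moreover have "N #> t \<in> rcosets N" using rc tu(1) by blast
    ultimately show "t = u" using T tu(1,2) unfolding right_transversal_def by blast
  qed
qed (rule N(2))

section \<open>The solution language\<close>

text \<open>Exponents are natural numbers up to sign, and \<open>s\<close> is the set of places with nonpositive exponent.
  A zero exponent is represented with either sign, which is harmless because both give the empty
  power.\<close>

definition signed :: "'i set \<Rightarrow> ('i \<Rightarrow> nat) \<Rightarrow> 'i \<Rightarrow> int" where
  "signed s x p = (if p \<in> s then - int (x p) else int (x p))"

text \<open>The absolute values of the exponents in those solutions for which the value of each variable \<open>v\<close>
  ends in \<open>t v\<close> and the exponents have the signs prescribed by \<open>s\<close>. Vectors vanish off \<open>V \<times> {1..k}\<close>,
  so that they are ordered like vectors with finitely many coordinates.\<close>

definition solution_exponents ::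
    "('a, 'c) monoid_scheme \<Rightarrow> nat \<Rightarrow> (nat \<Rightarrow> 'a) \<Rightarrow> 'v set \<Rightarrow>
     ('a + ('v \<times> bool) list set) list set set \<Rightarrow> ('v \<Rightarrow> 'a) \<Rightarrow> ('v \<times> nat) set \<Rightarrow>
     ('v \<times> nat \<Rightarrow> nat) set" where
  "solution_exponents G k a V S t s = {x. (\<forall>p. p \<notin> V \<times> {1..k} \<longrightarrow> x p = 0) \<and>
    (\<exists>\<psi>\<in>solutions G V S. \<forall>v\<in>V. \<psi> (free_gen V v) = normal_element G k a (\<lambda>i. signed s x (v, i)) (t v))}"

text \<open>All solutions counted here agree modulo \<open>H\<close>, as the value of \<open>v\<close> lies in the coset of \<open>t v\<close>. The
  heap operation applied to the solutions of \<open>z\<close>, \<open>x\<close> and \<open>y\<close> is the solution of \<open>z + (y - x)\<close>: since the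
  signs are fixed, the signed exponents are \<open>z - x + y\<close> up to a common sign at each place.\<close>

lemma (in normal) hybrid_linear_solution_exponents:
  assumes a: "free_abelian_basis G H k a" and sys: "equation_system G V S" and t: "t \<in> V \<rightarrow> carrier G"
  shows "hybrid_linear (solution_exponents G k a V S t s)"
proof (rule hybrid_linear_if_closed_under_translation)
  have H: "subgroup H G" by (rule subgroup_axioms)
  show "finite (V \<times> {1..k})" using sys by (simp add: equation_system_def)
  show supp: "x p = 0" if "x \<in> solution_exponents G k a V S t s" "p \<notin> V \<times> {1..k}" for x p
    using that unfolding solution_exponents_def by blast
  fix x y z
  assume x: "x \<in> solution_exponents G k a V S t s" and y: "y \<in> solution_exponents G k a V S t s"
    and z: "z \<in> solution_exponents G k a V S t s" and le: "x \<le> y"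
  let ?n = "\<lambda>x v. normal_element G k a (\<lambda>i. signed s x (v, i)) (t v)"
  obtain f where f: "f \<in> solutions G V S" "\<And>v. v \<in> V \<Longrightarrow> f (free_gen V v) = ?n z v"
    using z unfolding solution_exponents_def by blast
  obtain g where g: "g \<in> solutions G V S" "\<And>v. v \<in> V \<Longrightarrow> g (free_gen V v) = ?n x v"
    using x unfolding solution_exponents_def by blast
  obtain h where h: "h \<in> solutions G V S" "\<And>v. v \<in> V \<Longrightarrow> h (free_gen V v) = ?n y v"
    using y unfolding solution_exponents_def by blast
  have tG: "t v \<in> carrier G" if "v \<in> V" for v using t that by blast
  have cos: "H #> ?n x v = H #> t v" if "v \<in> V" for x v
    by (rule normal_element_rcos[OF H a tG[OF that]])
  have sol: "(\<lambda>u. f u \<otimes> inv (g u) \<otimes> h u) \<in> solutions G V S"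
    by (rule solutions_heap[OF free_abelian_basis_commute[OF a] _ f(1) g(1) h(1)])
      (use sys in \<open>simp_all add: equation_system_def f(2) g(2) h(2) cos\<close>)
  have val: "f (free_gen V v) \<otimes> inv (g (free_gen V v)) \<otimes> h (free_gen V v) = ?n (z + (y - x)) v"
    if v: "v \<in> V" for v
  proof -
    have "signed s z p - signed s x p + signed s y p = signed s (z + (y - x)) p" for p
      using le_funD[OF le, of p] by (auto simp: signed_def of_nat_diff)
    then show ?thesis using normal_element_heap[OF H a tG[OF v]] by (simp add: f(2) g(2) h(2) v)
  qed
  have zero: "(z + (y - x)) p = 0" if "p \<notin> V \<times> {1..k}" for p
    using supp[OF x that] supp[OF y that] supp[OF z that] by simp
  show "z + (y - x) \<in> solution_exponents G k a V S t s"
    unfolding solution_exponents_def mem_Collect_eq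
    by (intro conjI allI impI zero bexI[OF _ sol] ballI val)
qed

definition exponent_letter ::
    "('a, 'c) monoid_scheme \<Rightarrow> (nat \<Rightarrow> 'a) \<Rightarrow> ('v \<times> nat) set \<Rightarrow> 'v \<times> nat \<Rightarrow> 'a joined_letter" where
  "exponent_letter G a s = (\<lambda>(v, i). Letter (if (v, i) \<in> s then inv\<^bsub>G\<^esub> a i else a i))"

text \<open>The pattern is a joined word over letters and placeholders, so that it can be built by
  \<open>hash_join\<close> itself; the outer \<open>map\<close> only rearranges the sum type.\<close>

definition solution_pattern ::
    "nat \<Rightarrow> 'v list \<Rightarrow> ('v \<Rightarrow> 'a) \<Rightarrow> ('a joined_letter + 'v \<times> nat) list" where
  "solution_pattern k Xs t =
    map (\<lambda>z. case z of Letter (Inl c) \<Rightarrow> Inl (Letter c) | Letter (Inr p) \<Rightarrow> Inr p | Hash \<Rightarrow> Inl Hash)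
      (hash_join (map (\<lambda>v. map (\<lambda>i. Inr (v, i)) [1..<Suc k] @ [Inl (t v)]) Xs))"

lemma fill_solution_pattern:
  "fill (exponent_letter G a s) x (solution_pattern k Xs t) =
    hash_join (map (\<lambda>v. normal_word G k a (\<lambda>i. signed s x (v, i)) (t v)) Xs)"
proof -
  let ?g = "case_sum (\<lambda>c. [c]) (\<lambda>(v, i). replicate (x (v, i)) (if (v, i) \<in> s then inv\<^bsub>G\<^esub> a i else a i))"
  have power: "replicate (x (v, i)) (if (v, i) \<in> s then inv\<^bsub>G\<^esub> a i else a i) =
      power_word G (a i) (signed s x (v, i))" for v i
    by (auto simp: power_word_def signed_def)
  have "fill (exponent_letter G a s) x (solution_pattern k Xs t) =
      hash_join (map (\<lambda>u. concat (map ?g u))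
        (map (\<lambda>v. map (\<lambda>i. Inr (v, i)) [1..<Suc k] @ [Inl (t v)]) Xs))"
    unfolding fill_def solution_pattern_def map_map[of _ _ "hash_join _"]
    by (rule concat_map_hash_join)
      (auto simp: exponent_letter_def split: sum.split)
  also have "\<dots> = hash_join (map (\<lambda>v. normal_word G k a (\<lambda>i. signed s x (v, i)) (t v)) Xs)"
    by (simp add: normal_word_def comp_def power del: upt_Suc)
  finally show ?thesis .
qed

lemma set_solution_pattern:
  assumes "t \<in> set Xs \<rightarrow> T"
  shows "set (solution_pattern k Xs t) \<subseteq> insert Hash (Letter ` T) <+> set Xs \<times> {1..k}"
proof -
  let ?us = "map (\<lambda>v. map (\<lambda>i. Inr (v, i)) [1..<Suc k] @ [Inl (t v)]) Xs"
  have "(\<Union>u\<in>set ?us. set u) \<subseteq> T <+> set Xs \<times> {1..k}" using assms by auto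
  then have "set (hash_join ?us) \<subseteq> insert Hash (Letter ` (T <+> set Xs \<times> {1..k}))"
    using set_hash_join[of ?us] by blast
  then show ?thesis unfolding solution_pattern_def set_map by (rule image_mono[THEN subset_trans]) auto
qed

text \<open>For the inclusion from left to right, write the value of each variable in normal form, let \<open>t\<close>
  collect the transversal letters, \<open>s\<close> the places with negative exponent, and \<open>x\<close> the absolute values.\<close>

lemma (in normal) joined_solution_language_eq:
  assumes a: "free_abelian_basis G H k a" and T: "right_transversal G H T"
  shows "joined_solution_language G (normal_form G k a T) Xs S =
    (\<Union>(t, s)\<in>(set Xs \<rightarrow>\<^sub>E T) \<times> Pow (set Xs \<times> {1..k}).
      {fill (exponent_letter G a s) x (solution_pattern k Xs t) | x.
        x \<in> solution_exponents G k a (set Xs) S t s})"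
    (is "?L = ?R")
proof -
  let ?V = "set Xs"
  have H: "subgroup H G" by (rule subgroup_axioms)
  have TG: "T \<subseteq> carrier G" using T by (simp add: right_transversal_def)
  have word: "hash_join (map (\<lambda>v. normal_form G k a T (\<psi> (free_gen ?V v))) Xs) =
      fill (exponent_letter G a s) x (solution_pattern k Xs t)"
    if "t \<in> ?V \<rightarrow> T"
      "\<And>v. v \<in> ?V \<Longrightarrow> \<psi> (free_gen ?V v) = normal_element G k a (\<lambda>i. signed s x (v, i)) (t v)"
    for \<psi> t s x
    using that unfolding fill_solution_pattern
    by (auto simp: normal_form_normal_element[OF H a T] Pi_iff intro!: arg_cong[of _ _ hash_join])
  show ?thesis
  proof (intro equalityI subsetI)
    fix w assume "w \<in> ?L"
    then obtain \<psi> where \<psi>: "\<psi> \<in> solutions G ?V S"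
      and w: "w = hash_join (map (\<lambda>v. normal_form G k a T (\<psi> (free_gen ?V v))) Xs)"
      unfolding joined_solution_language_def by blast
    have "\<psi> (free_gen ?V v) \<in> carrier G" if "v \<in> ?V" for v
    proof (rule hom_in_carrier[of \<psi> "free_group ?V"])
      show "\<psi> \<in> hom (free_group ?V) G" using \<psi> by (simp add: solutions_def)
      show "free_gen ?V v \<in> carrier (free_group ?V)"
        unfolding free_gen_def free_group_def by (rule word_class_closed) (use that in auto)
    qed
    then have "\<forall>v\<in>?V. \<exists>e u. u \<in> T \<and> \<psi> (free_gen ?V v) = normal_element G k a e u"
      using normal_element_exists[OF H a T] by metis
    then obtain e u where eu: "\<And>v. v \<in> ?V \<Longrightarrow> u v \<in> T"
      "\<And>v. v \<in> ?V \<Longrightarrow> \<psi> (free_gen ?V v) = normal_element G k a (e v) (u v)"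
      by metis
    define t where "t = restrict u ?V"
    define s where "s = {(v, i) \<in> ?V \<times> {1..k}. e v i < 0}"
    define x where "x = (\<lambda>(v, i). if v \<in> ?V \<and> i \<in> {1..k} then nat \<bar>e v i\<bar> else 0)"
    have t: "t \<in> ?V \<rightarrow>\<^sub>E T" using eu(1) by (auto simp: t_def)
    have "signed s x (v, i) = e v i" if "v \<in> ?V" "i \<in> {1..k}" for v i
      using that by (auto simp: signed_def s_def x_def)
    then have \<psi>x: "\<psi> (free_gen ?V v) = normal_element G k a (\<lambda>i. signed s x (v, i)) (t v)" if "v \<in> ?V" for v
      using eu(2)[OF that] that normal_element_cong[of k "\<lambda>i. signed s x (v, i)" "e v"] by (simp add: t_def)
    have "x \<in> solution_exponents G k a ?V S t s"
      unfolding solution_exponents_def using \<psi> \<psi>x by (auto simp: x_def)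
    moreover have "s \<in> Pow (?V \<times> {1..k})" by (auto simp: s_def)
    moreover have "w = fill (exponent_letter G a s) x (solution_pattern k Xs t)"
      unfolding w by (rule word) (use t \<psi>x in auto)
    ultimately show "w \<in> ?R" using t by blast
  next
    fix w assume "w \<in> ?R"
    then obtain t s x where t: "t \<in> ?V \<rightarrow>\<^sub>E T" and x: "x \<in> solution_exponents G k a ?V S t s"
      and w: "w = fill (exponent_letter G a s) x (solution_pattern k Xs t)" by blast
    obtain \<psi> where \<psi>: "\<psi> \<in> solutions G ?V S"
      "\<And>v. v \<in> ?V \<Longrightarrow> \<psi> (free_gen ?V v) = normal_element G k a (\<lambda>i. signed s x (v, i)) (t v)"
      using x unfolding solution_exponents_def by blast
    have "w = hash_join (map (\<lambda>v. normal_form G k a T (\<psi> (free_gen ?V v))) Xs)"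
      unfolding w by (rule word[symmetric]) (use t \<psi>(2) in auto)
    then show "w \<in> ?L" using \<psi>(1) unfolding joined_solution_language_def by blast
  qed
qed

theorem corollary3p13:
  fixes G :: "('a, 'c) monoid_scheme" and N T :: "'a set" and a :: "nat \<Rightarrow> 'a" and k :: nat
    and Xs :: "'v list" and S :: "('a + ('v \<times> bool) list set) list set set"
  assumes "finitely_generated_group G" and "virtually_abelian_group G"
    and "N \<lhd> G" and "finite (rcosets\<^bsub>G\<^esub> N)"
    and "free_abelian_basis G N k a"
    and "right_transversal G N T"
    and "distinct Xs" and "equation_system G (set Xs) S"
  shows "EDT0L_language (insert Hash (Letter ` (standard_generators G k a \<union> T)))
    (joined_solution_language G (normal_form G k a T) Xs S)"
proof -
  interpret normal N G by fact
  let ?\<Omega> = "insert Hash (Letter ` (standard_generators G k a \<union> T))" and ?V = "set Xs \<times> {1..k}"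
  let ?J = "(set Xs \<rightarrow>\<^sub>E T) \<times> Pow ?V"
  have T: "finite T" "T \<subseteq> carrier G"
    using finite_right_transversal[OF subgroup_axioms assms(4,6)] assms(6)
    by (auto simp: right_transversal_def)
  have "EDT0L_language ?\<Omega> (\<Union>j\<in>?J. {fill (exponent_letter G a (snd j)) x (solution_pattern k Xs (fst j)) | x.
      x \<in> solution_exponents G k a (set Xs) S (fst j) (snd j)})"
  proof (rule EDT0L_language_fill)
    show "finite ?\<Omega>" using T(1) by (simp add: standard_generators_def)
    show "finite ?V" by simp
    then show "finite ?J" using T(1) by (simp add: finite_PiE)
    fix j assume j: "j \<in> ?J"
    then have t: "fst j \<in> set Xs \<rightarrow> T" by (auto simp: mem_Times_iff PiE_iff)
    show "set (solution_pattern k Xs (fst j)) \<subseteq> ?\<Omega> <+> ?V"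
      using set_solution_pattern[OF t, of k] by blast
    show "exponent_letter G a (snd j) p \<in> ?\<Omega>" if "p \<in> ?V" for p
      using that by (auto simp: exponent_letter_def standard_generators_def)
    show "hybrid_linear (solution_exponents G k a (set Xs) S (fst j) (snd j))"
      using t T(2) by (intro hybrid_linear_solution_exponents assms) auto
  qed
  then show ?thesis
    unfolding joined_solution_language_eq[OF assms(5,6)] by (simp add: case_prod_beta)
qed

end
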